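(* Let $U\subset\mathbb{R}^2$ be a domain, $f:U\to\mathbb{R}^3$ a smooth embedding, and $p\in U$ a point at which the Gaussian curvature $K_p$ of $f$ is negative. Let $\mathbf{v}\in T_pU$ be a non-zero tangent vector giving an asymptotic direction of $f$ at $p$. Let $\alpha_p(\mathbf{v})$, $\rho_p(\mathbf{v})$ and $\beta_p(\mathbf{v})$ be, respectively, the horizontal curvature, the vertical torsion and the asymptotic curvature of $f$ at $p$ with respect to $\mathbf{v}$. Then $$|\alpha_p(\mathbf{v})|=\frac{2}{3}\,\beta_p(\mathbf{v}).$$ Moreover, if $\beta_p(\mathbf{v})>0$, so that the asymptotic torsion $\delta_p(\mathbf{v})$ of $f$ at $p$ with respect to $\mathbf{v}$ is defined, then $$|\delta_p(\mathbf{v})|\,\beta_p(\mathbf{v})=\frac{|\rho_p(\mathbf{v})|}{2}$$ and $$K_p=-\frac{\rho_p(\mathbf{v})^2}{9\,\alpha_p(\mathbf{v})^2}.$$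
   Context: "Smooth" means $C^\infty$. Let $\nu$ be a smooth unit normal vector field of $f$ on $U$, and put $V:=df_p(\mathbf{v})$. A non-zero vector $\mathbf{v}\in T_pU$ gives an asymptotic direction if the normal curvature of $f$ at $p$ in the direction $\mathbf{v}$ is zero, i.e. the second fundamental form satisfies $II_p(\mathbf{v},\mathbf{v})=0$. A point of $U$ is identified with its image under $f$, and tangent vectors to $U$ with their images under $df$. Let $\mathbf{T}_p$ be the affine tangent plane of $f$ through $f(p)$ (perpendicular to $\nu_p$), and let $N_V$ be the plane through $f(p)$ spanned by $\nu_p$ and $V$. Vertical torsion $\rho_p(\mathbf{v})$: the section $\mathcal{S}_p$ of the image of $f$ by the plane $N_V$ is, near $f(p)$, a regular plane curve with an inflection point at $f(p)$. $\rho_p(\mathbf{v})$ is the derivative at $f(p)$, with respect to arc length, of the curvature function of the plane curve $\mathcal{S}_p$ in $N_V$ (its sign depends on choices of orientation, which are irrelevant here). Horizontal curvature $\alpha_p(\mathbf{v})$: let $\sigma:I\to U$ be a regular curve on an open interval $I\ni 0$ with $\sigma(0)=p$, $\sigma'(0)=\mathbf{v}$ and $f\circ\sigma(I)\subset \mathbf{T}_p$ (since $K_p<0$, such a curve exists and its image near $p$ is unique). Orient $\mathbf{T}_p$ so that $(V,\nu_p\times V)$ is a positive frame. $\alpha_p(\mathbf{v})$ is the (signed) curvature at $t=0$ of $f\circ\sigma$ as a curve in the oriented plane $\mathbf{T}_p$. Asymptotic curvature $\beta_p(\mathbf{v})$ and asymptotic torsion $\delta_p(\mathbf{v})$: let $\tau:I\to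 U$ be a regular curve on an open interval $I\ni 0$ with $\tau(0)=p$, $\tau'(0)$ a positive scalar multiple of $\mathbf{v}$, and $\tau'(t)$ pointing in an asymptotic direction of $f$ at $\tau(t)$ for every $t\in I$ (the asymptotic curve through $p$ with respect to $\mathbf{v}$). $\beta_p(\mathbf{v})$ and $\delta_p(\mathbf{v})$ are the curvature and the torsion at $t=0$ of the space curve $\hat\tau=f\circ\tau$ in $\mathbb{R}^3$ (the torsion being defined when the curvature is positive). *)

theory Defs
  imports "HOL-Analysis.Analysis"
begin

section \<open>Smooth maps, regular curves, embedded surface patches\<close>

text \<open>
  Only meant for open \<open>S\<close>. The successor clause asks that \<open>g\<close> is differentiable and that
  all its directional derivatives are \<open>n\<close> times continuously differentiable; for \<open>S\<close> open in
  a finite-dimensional space this is the usual notion of class \<open>C\<^sup>n\<close>.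
\<close>

fun Cn_on :: "nat \<Rightarrow> 'a::real_normed_vector set \<Rightarrow> ('a \<Rightarrow> 'b::real_normed_vector) \<Rightarrow> bool" where
  "Cn_on 0 S g \<longleftrightarrow> continuous_on S g"
| "Cn_on (Suc n) S g \<longleftrightarrow>
     (\<forall>x\<in>S. g differentiable (at x)) \<and>
     (\<forall>w. Cn_on n S (\<lambda>x. frechet_derivative g (at x) w))"

definition smooth_on :: "'a::real_normed_vector set \<Rightarrow> ('a \<Rightarrow> 'b::real_normed_vector) \<Rightarrow> bool" where
  "smooth_on S g \<longleftrightarrow> (\<forall>n. Cn_on n S g)"

definition smooth_embedding_on :: "(real^2) set \<Rightarrow> (real^2 \<Rightarrow> real^3) \<Rightarrow> bool" where
  "smooth_embedding_on U f \<longleftrightarrow>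
     smooth_on U f \<and>
     (\<forall>x\<in>U. inj (frechet_derivative f (at x))) \<and>
     (\<exists>g. homeomorphism U (f ` U) f g)"

definition unit_normal_field :: "(real^2) set \<Rightarrow> (real^2 \<Rightarrow> real^3) \<Rightarrow> (real^2 \<Rightarrow> real^3) \<Rightarrow> bool" where
  "unit_normal_field U f \<nu> \<longleftrightarrow>
     smooth_on U \<nu> \<and>
     (\<forall>x\<in>U. norm (\<nu> x) = 1 \<and> (\<forall>w. \<nu> x \<bullet> frechet_derivative f (at x) w = 0))"

abbreviation curve_deriv :: "nat \<Rightarrow> (real \<Rightarrow> 'a::real_normed_vector) \<Rightarrow> real \<Rightarrow> 'a" where
  "curve_deriv k c \<equiv> ((\<lambda>g t. vector_derivative g (at t)) ^^ k) c"

text \<open>Parameter intervals are open intervals (possibly unbounded) containing 0.\<close>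

definition regular_curve_on :: "real set \<Rightarrow> (real \<Rightarrow> 'a::real_normed_vector) \<Rightarrow> bool" where
  "regular_curve_on I c \<longleftrightarrow>
     open I \<and> is_interval I \<and> 0 \<in> I \<and> smooth_on I c \<and> (\<forall>t\<in>I. curve_deriv 1 c t \<noteq> 0)"

section \<open>Curvature and torsion of curves\<close>

text \<open>The parameter of the curves need not be arc length.\<close>

definition space_curvature :: "(real \<Rightarrow> real^3) \<Rightarrow> real \<Rightarrow> real" where
  "space_curvature c t =
     norm (cross3 (curve_deriv 1 c t) (curve_deriv 2 c t)) / norm (curve_deriv 1 c t) ^ 3"

definition space_torsion :: "(real \<Rightarrow> real^3) \<Rightarrow> real \<Rightarrow> real" where
  "space_torsion c t =
     (cross3 (curve_deriv 1 c t) (curve_deriv 2 c t) \<bullet> curve_deriv 3 c t) /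
     norm (cross3 (curve_deriv 1 c t) (curve_deriv 2 c t)) ^ 2"

text \<open>
  Signed curvature of a curve \<open>c\<close> lying in an affine plane with unit normal \<open>n\<close>, the plane being
  oriented so that \<open>(a, n \<times> a)\<close> is a positive frame for every non-zero \<open>a\<close> parallel to it.
\<close>

definition plane_curvature :: "real^3 \<Rightarrow> (real \<Rightarrow> real^3) \<Rightarrow> real \<Rightarrow> real" where
  "plane_curvature n c t =
     (cross3 (curve_deriv 1 c t) (curve_deriv 2 c t) \<bullet> n) / norm (curve_deriv 1 c t) ^ 3"

section \<open>Fundamental forms and Gaussian curvature\<close>

definition first_fundamental_form ::
    "(real^2 \<Rightarrow> real^3) \<Rightarrow> real^2 \<Rightarrow> real^2 \<Rightarrow> real^2 \<Rightarrow> real" where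
  "first_fundamental_form f p v w =
     frechet_derivative f (at p) v \<bullet> frechet_derivative f (at p) w"

definition second_fundamental_form ::
    "(real^2 \<Rightarrow> real^3) \<Rightarrow> (real^2 \<Rightarrow> real^3) \<Rightarrow> real^2 \<Rightarrow> real^2 \<Rightarrow> real^2 \<Rightarrow> real" where
  "second_fundamental_form f \<nu> p v w =
     frechet_derivative (\<lambda>x. frechet_derivative f (at x) v) (at p) w \<bullet> \<nu> p"

definition gaussian_curvature ::
    "(real^2 \<Rightarrow> real^3) \<Rightarrow> (real^2 \<Rightarrow> real^3) \<Rightarrow> real^2 \<Rightarrow> real" where
  "gaussian_curvature f \<nu> p =
     det (\<chi> i j. second_fundamental_form f \<nu> p (axis i 1) (axis j 1) :: real^2^2) /
     det (\<chi> i j. first_fundamental_form f p (axis i 1) (axis j 1) :: real^2^2)"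

definition asymptotic_direction ::
    "(real^2 \<Rightarrow> real^3) \<Rightarrow> (real^2 \<Rightarrow> real^3) \<Rightarrow> real^2 \<Rightarrow> real^2 \<Rightarrow> bool" where
  "asymptotic_direction f \<nu> p v \<longleftrightarrow> v \<noteq> 0 \<and> second_fundamental_form f \<nu> p v v = 0"

section \<open>The invariants of an asymptotic direction\<close>

text \<open>
  Each invariant is defined through a curve that is not itself an explicit function of the data,
  so it is given as a relation: the number is the one computed from some admissible curve.
\<close>

definition tangent_plane :: "(real^2 \<Rightarrow> real^3) \<Rightarrow> (real^2 \<Rightarrow> real^3) \<Rightarrow> real^2 \<Rightarrow> (real^3) set" where
  "tangent_plane f \<nu> p = {x. (x - f p) \<bullet> \<nu> p = 0}"

definition normal_plane ::
    "(real^2 \<Rightarrow> real^3) \<Rightarrow> (real^2 \<Rightarrow> real^3) \<Rightarrow> real^2 \<Rightarrow> real^2 \<Rightarrow> (real^3) set" where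
  "normal_plane f \<nu> p v = (\<lambda>x. f p + x) ` span {\<nu> p, frechet_derivative f (at p) v}"

text \<open>
  The curve \<open>c\<close> parametrizes the section of the surface by the normal plane, inside some
  neighbourhood \<open>W\<close> of \<open>f p\<close>. As \<open>c\<close> need not have unit speed, the derivative with respect to
  arc length is the derivative in the parameter divided by the speed. The plane is oriented
  by its unit normal \<open>sgn (\<nu> p \<times> V)\<close>.
\<close>

definition has_vertical_torsion ::
    "(real^2) set \<Rightarrow> (real^2 \<Rightarrow> real^3) \<Rightarrow> (real^2 \<Rightarrow> real^3) \<Rightarrow> real^2 \<Rightarrow> real^2 \<Rightarrow> real \<Rightarrow> bool" where
  "has_vertical_torsion U f \<nu> p v \<rho> \<longleftrightarrow>
     (\<exists>I c W. regular_curve_on I c \<and> c 0 = f p \<and>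
        open W \<and> c ` I = f ` U \<inter> normal_plane f \<nu> p v \<inter> W \<and>
        \<rho> = deriv (plane_curvature (sgn (cross3 (\<nu> p) (frechet_derivative f (at p) v))) c) 0
            / norm (curve_deriv 1 c 0))"

definition has_horizontal_curvature ::
    "(real^2) set \<Rightarrow> (real^2 \<Rightarrow> real^3) \<Rightarrow> (real^2 \<Rightarrow> real^3) \<Rightarrow> real^2 \<Rightarrow> real^2 \<Rightarrow> real \<Rightarrow> bool" where
  "has_horizontal_curvature U f \<nu> p v \<alpha> \<longleftrightarrow>
     (\<exists>I \<sigma>. regular_curve_on I \<sigma> \<and> \<sigma> ` I \<subseteq> U \<and> \<sigma> 0 = p \<and> curve_deriv 1 \<sigma> 0 = v \<and>
        (f \<circ> \<sigma>) ` I \<subseteq> tangent_plane f \<nu> p \<and>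
        \<alpha> = plane_curvature (\<nu> p) (f \<circ> \<sigma>) 0)"

definition asymptotic_curve ::
    "(real^2) set \<Rightarrow> (real^2 \<Rightarrow> real^3) \<Rightarrow> (real^2 \<Rightarrow> real^3) \<Rightarrow> real^2 \<Rightarrow> real^2
      \<Rightarrow> real set \<Rightarrow> (real \<Rightarrow> real^2) \<Rightarrow> bool" where
  "asymptotic_curve U f \<nu> p v I \<tau> \<longleftrightarrow>
     regular_curve_on I \<tau> \<and> \<tau> ` I \<subseteq> U \<and> \<tau> 0 = p \<and>
     (\<exists>r>0. curve_deriv 1 \<tau> 0 = r *\<^sub>R v) \<and>
     (\<forall>t\<in>I. asymptotic_direction f \<nu> (\<tau> t) (curve_deriv 1 \<tau> t))"

definition has_asymptotic_curvature ::
    "(real^2) set \<Rightarrow> (real^2 \<Rightarrow> real^3) \<Rightarrow> (real^2 \<Rightarrow> real^3) \<Rightarrow> real^2 \<Rightarrow> real^2 \<Rightarrow> real \<Rightarrow> bool" where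
  "has_asymptotic_curvature U f \<nu> p v \<beta> \<longleftrightarrow>
     (\<exists>I \<tau>. asymptotic_curve U f \<nu> p v I \<tau> \<and> \<beta> = space_curvature (f \<circ> \<tau>) 0)"

definition has_asymptotic_torsion ::
    "(real^2) set \<Rightarrow> (real^2 \<Rightarrow> real^3) \<Rightarrow> (real^2 \<Rightarrow> real^3) \<Rightarrow> real^2 \<Rightarrow> real^2 \<Rightarrow> real \<Rightarrow> bool" where
  "has_asymptotic_torsion U f \<nu> p v \<delta> \<longleftrightarrow>
     (\<exists>I \<tau>. asymptotic_curve U f \<nu> p v I \<tau> \<and> space_curvature (f \<circ> \<tau>) 0 > 0 \<and>
        \<delta> = space_torsion (f \<circ> \<tau>) 0)"

end

theory Submission
  imports Defs
begin

text \<open>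
  Put \<open>V = df(v)\<close>. In an asymptotic direction \<open>D\<nu>(v)\<close> is orthogonal to both \<open>\<nu>\<close> and \<open>V\<close>, hence
  \<open>D\<nu>(v) = - m (\<nu> \<times> V)\<close>, and \<open>K = - m\<^sup>2\<close>. There is a number \<open>T\<close>, depending only on \<open>f\<close>, \<open>\<nu>\<close>
  and \<open>v\<close>, such that every curve \<open>c = f \<circ> \<gamma>\<close> on the surface with \<open>\<gamma>'(0) = l v\<close> satisfies at \<open>0\<close>
  \<open>II(\<gamma>', \<gamma>')' = l\<^sup>3 T - 2 l (D\<nu>(v) \<bullet> c'')\<close> and \<open>c''' \<bullet> \<nu> = l\<^sup>3 T - 3 l (D\<nu>(v) \<bullet> c'')\<close>.
  The first expression vanishes for the asymptotic curve and the second one for the section by the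
  tangent plane, while \<open>D\<nu>(v) \<bullet> c'' = 0\<close> for the section by the normal plane. Since
  \<open>D\<nu>(v) \<bullet> c'' = - m ((V \<times> c'') \<bullet> \<nu>)\<close>, this gives
  \<open>3 \<bar>m\<bar> \<bar>\<alpha>\<bar> = 2 \<bar>m\<bar> \<beta> = \<bar>\<rho>\<bar> = \<bar>T\<bar> / \<bar>V\<bar>\<^sup>3\<close> and \<open>\<delta> = m\<close>.
\<close>

section \<open>Smooth maps and curves\<close>

text \<open>On an open set the derivative at a point depends only on nearby values, so agreement on
  \<open>S\<close> passes to the directional derivatives and the induction on \<open>n\<close> goes
  through.\<close>

lemma Cn_on_cong:
  assumes "open S" "\<And>x. x \<in> S \<Longrightarrow> g x = h x" "Cn_on n S g"
  shows "Cn_on n S h"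
  using assms(2,3)
proof (induction n arbitrary: g h)
  case 0
  then show ?case
    using continuous_on_eq by force
next
  case (Suc n)
  have d: "(h has_derivative frechet_derivative g (at x)) (at x)" if "x \<in> S" for x
    using Suc.prems that has_derivative_transform_within_open[OF _ assms(1) that, of g]
    by (auto simp: frechet_derivative_works)
  then have "frechet_derivative g (at x) = frechet_derivative h (at x)" if "x \<in> S" for x
    using frechet_derivative_at that by blast
  then have "Cn_on n S (\<lambda>x. frechet_derivative h (at x) w)" for w
    using Suc.IH[of "\<lambda>x. frechet_derivative g (at x) w"] Suc.prems(2) by auto
  with d show ?case
    by (auto simp: differentiable_def)
qed

lemma smooth_on_has_derivative:
  assumes "smooth_on S g" "x \<in> S"
  shows "(g has_derivative frechet_derivative g (at x)) (at x)"
proof -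
  have "Cn_on (Suc 0) S g"
    using assms by (simp add: smooth_on_def del: Cn_on.simps)
  then show ?thesis
    using assms(2) by (simp add: frechet_derivative_works)
qed

lemma smooth_on_frechet_derivative:
  assumes "smooth_on S g"
  shows "smooth_on S (\<lambda>x. frechet_derivative g (at x) w)"
  using assms unfolding smooth_on_def by (metis Cn_on.simps(2))

lemma smooth_on_continuous_on: "smooth_on S g \<Longrightarrow> continuous_on S g"
  using Cn_on.simps(1) smooth_on_def by blast

lemma smooth_on_has_vector_derivative:
  assumes "smooth_on I c" "t \<in> I"
  shows "(c has_vector_derivative vector_derivative c (at t)) (at t)"
  using assms smooth_on_has_derivative
  by (metis differentiable_def vector_derivative_works)

text \<open>On \<open>I\<close> the vector derivative is the Frechet derivative applied to 1. This
  identity is known on \<open>I\<close> only, so \<open>Cn_on_cong\<close> is used to transfer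
  smoothness.\<close>

lemma smooth_on_vector_derivative:
  assumes "smooth_on I c" "open I"
  shows "smooth_on I (\<lambda>t. vector_derivative c (at t))"
proof -
  have "frechet_derivative c (at t) 1 = vector_derivative c (at t)" if "t \<in> I" for t
  proof -
    have "(c has_derivative (\<lambda>h. h *\<^sub>R vector_derivative c (at t))) (at t)"
      using smooth_on_has_vector_derivative[OF assms(1) that] by (simp add: has_vector_derivative_def)
    then show ?thesis
      using frechet_derivative_at by (metis scaleR_one)
  qed
  then show ?thesis
    using smooth_on_frechet_derivative[OF assms(1), of 1] Cn_on_cong[OF assms(2), of "\<lambda>t. frechet_derivative c (at t) 1"]
    unfolding smooth_on_def by simp
qed

lemma smooth_on_curve_deriv:
  assumes "smooth_on I c" "open I"
  shows "smooth_on I (curve_deriv k c)"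
  by (induction k) (use assms smooth_on_vector_derivative in auto)

lemma curve_deriv_has_vector_derivative:
  assumes "smooth_on I c" "open I" "t \<in> I"
  shows "(c has_vector_derivative curve_deriv 1 c t) (at t)"
    and "(curve_deriv 1 c has_vector_derivative curve_deriv 2 c t) (at t)"
    and "(curve_deriv 2 c has_vector_derivative curve_deriv 3 c t) (at t)"
proof -
  have "(curve_deriv k c has_vector_derivative curve_deriv (Suc k) c t) (at t)" for k
    using smooth_on_has_vector_derivative[OF smooth_on_curve_deriv[OF assms(1,2)] assms(3)] by simp
  from this[of 0] this[of 1] this[of 2]
  show "(c has_vector_derivative curve_deriv 1 c t) (at t)"
    and "(curve_deriv 1 c has_vector_derivative curve_deriv 2 c t) (at t)"
    and "(curve_deriv 2 c has_vector_derivative curve_deriv 3 c t) (at t)"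
    by (simp_all add: eval_nat_numeral)
qed

text \<open>Each derivative has to be identified on a whole open set before it can be differentiated
  again; hence only the third one is taken at a single point.\<close>

lemma curve_deriv_eqI:
  assumes "open I" "t0 \<in> I"
    and "\<And>t. t \<in> I \<Longrightarrow> (c has_vector_derivative c1 t) (at t)"
    and "\<And>t. t \<in> I \<Longrightarrow> (c1 has_vector_derivative c2 t) (at t)"
    and "(c2 has_vector_derivative c3) (at t0)"
  shows "\<And>t. t \<in> I \<Longrightarrow> curve_deriv 1 c t = c1 t"
    and "\<And>t. t \<in> I \<Longrightarrow> curve_deriv 2 c t = c2 t"
    and "curve_deriv 3 c t0 = c3"
proof -
  show 1: "curve_deriv 1 c t = c1 t" if "t \<in> I" for t
    using assms(3)[OF that] by (simp add: vector_derivative_at)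
  have "(curve_deriv 1 c has_vector_derivative c2 t) (at t)" if "t \<in> I" for t
    using assms(4)[OF that] assms(1) that
    by (rule has_vector_derivative_transform_within_open) (simp only: 1)
  then show 2: "curve_deriv 2 c t = c2 t" if "t \<in> I" for t
    using that by (simp add: vector_derivative_at numeral_2_eq_2)
  have "(curve_deriv 2 c has_vector_derivative c3) (at t0)"
    using assms(5) assms(1) assms(2)
    by (rule has_vector_derivative_transform_within_open) (simp only: 2)
  then show "curve_deriv 3 c t0 = c3"
    by (simp add: vector_derivative_at numeral_3_eq_3 numeral_2_eq_2)
qed

section \<open>Differential calculus\<close>

lemma has_derivative_along_line:
  fixes \<phi> :: "'a::real_normed_vector \<Rightarrow> real"
  assumes "(\<phi> has_derivative \<phi>') (at (q + s *\<^sub>R v))"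
  shows "((\<lambda>s. \<phi> (q + s *\<^sub>R v)) has_real_derivative \<phi>' v) (at s)"
proof -
  have "((\<lambda>s. q + s *\<^sub>R v) has_vector_derivative v) (at s)"
    by (auto intro!: derivative_eq_intros simp: has_vector_derivative_def)
  then have "((\<phi> \<circ> (\<lambda>s. q + s *\<^sub>R v)) has_vector_derivative \<phi>' v) (at s)"
    by (rule vector_derivative_diff_chain_within) (use assms has_derivative_at_withinI in blast)
  then show ?thesis
    by (simp add: has_real_derivative_iff_has_vector_derivative o_def)
qed

text \<open>The mean value theorem is applied twice: along \<open>v\<close> to the increment of
  \<phi> in direction \<open>w\<close>, then along \<open>w\<close> to the resulting increment of
  the derivative in direction \<open>v\<close>.\<close>

lemma second_difference_mean_value:
  fixes \<phi> :: "'a::real_normed_vector \<Rightarrow> real"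
  assumes h: "h > 0"
    and U: "\<And>s t. s \<in> {0..h} \<Longrightarrow> t \<in> {0..h} \<Longrightarrow> p + s *\<^sub>R v + t *\<^sub>R w \<in> U"
    and d1: "\<And>x. x \<in> U \<Longrightarrow> (\<phi> has_derivative \<phi>' x) (at x)"
    and d2: "\<And>x. x \<in> U \<Longrightarrow> ((\<lambda>y. \<phi>' y v) has_derivative A x) (at x)"
  obtains s t where "s \<in> {0..h}" "t \<in> {0..h}"
    "\<phi> (p + h *\<^sub>R v + h *\<^sub>R w) - \<phi> (p + h *\<^sub>R v) - \<phi> (p + h *\<^sub>R w) + \<phi> p
      = h * h * A (p + s *\<^sub>R v + t *\<^sub>R w) w"
proof -
  define g where "g s = \<phi> (p + h *\<^sub>R w + s *\<^sub>R v) - \<phi> (p + s *\<^sub>R v)" for s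
  have "(g has_real_derivative \<phi>' (p + h *\<^sub>R w + s *\<^sub>R v) v - \<phi>' (p + s *\<^sub>R v) v) (at s)"
    if "0 \<le> s" "s \<le> h" for s
    unfolding g_def
    using U[of s h] U[of s 0] h that d1
    by (intro DERIV_diff has_derivative_along_line) (auto simp: add_ac)
  from MVT2[OF h this] obtain s where s: "0 < s" "s < h"
    "g h - g 0 = h * (\<phi>' (p + h *\<^sub>R w + s *\<^sub>R v) v - \<phi>' (p + s *\<^sub>R v) v)"
    by auto
  have "((\<lambda>t. \<phi>' (p + s *\<^sub>R v + t *\<^sub>R w) v) has_real_derivative A (p + s *\<^sub>R v + t *\<^sub>R w) w) (at t)"
    if "0 \<le> t" "t \<le> h" for t
    using U[of s t] s that d2 by (intro has_derivative_along_line[of "\<lambda>x. \<phi>' x v"]) auto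
  from MVT2[OF h this] obtain t where t: "0 < t" "t < h"
    "\<phi>' (p + s *\<^sub>R v + h *\<^sub>R w) v - \<phi>' (p + s *\<^sub>R v) v = h * A (p + s *\<^sub>R v + t *\<^sub>R w) w"
    by auto
  show thesis
    by (rule that[of s t]) (use s t in \<open>auto simp: g_def add_ac\<close>)
qed

text \<open>The second difference over a parallelogram is symmetric in \<open>v\<close> and
  \<open>w\<close>. It equals the same multiple of either mixed derivative at some point of the
  parallelogram, and continuity at \<open>p\<close> identifies the two as the parallelogram
  shrinks.\<close>

lemma second_derivative_symmetric:
  fixes \<phi> :: "'a::real_normed_vector \<Rightarrow> real"
  assumes "open U" "p \<in> U"
    and d1: "\<And>x. x \<in> U \<Longrightarrow> (\<phi> has_derivative \<phi>' x) (at x)"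
    and dv: "\<And>x. x \<in> U \<Longrightarrow> ((\<lambda>y. \<phi>' y v) has_derivative A x) (at x)"
    and dw: "\<And>x. x \<in> U \<Longrightarrow> ((\<lambda>y. \<phi>' y w) has_derivative B x) (at x)"
    and cA: "isCont (\<lambda>x. A x w) p" and cB: "isCont (\<lambda>x. B x v) p"
  shows "A p w = B p v"
proof -
  have "\<bar>A p w - B p v\<bar> < e" if e: "e > 0" for e
  proof -
    from cA e obtain d1 where d1: "d1 > 0" "\<And>x. dist x p < d1 \<Longrightarrow> dist (A x w) (A p w) < e / 2"
      unfolding continuous_at_eps_delta by (meson half_gt_zero)
    from cB e obtain d2 where d2: "d2 > 0" "\<And>x. dist x p < d2 \<Longrightarrow> dist (B x v) (B p v) < e / 2"
      unfolding continuous_at_eps_delta by (meson half_gt_zero)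
    from assms(1,2) obtain d3 where d3: "d3 > 0" "\<And>x. dist x p < d3 \<Longrightarrow> x \<in> U"
      unfolding open_dist by blast
    define d where "d = min d1 (min d2 d3)"
    \<comment> \<open>The summand 1 keeps \<open>M\<close> positive even for
      \<open>v = w = 0\<close>. With \<open>h * M = d / 2\<close> the whole parallelogram stays
      within distance \<open>d\<close> of \<open>p\<close>.\<close>
    define M where "M = norm v + norm w + 1"
    define h where "h = d / (2 * M)"
    have M: "M > 0"
      by (simp add: M_def add_nonneg_pos)
    have "d > 0"
      using d1 d2 d3 by (simp add: d_def)
    then have h: "h > 0"
      using M by (simp add: h_def)
    have near: "dist (p + s *\<^sub>R v + t *\<^sub>R w) p < d" if "s \<in> {0..h}" "t \<in> {0..h}" for s t
    proof -
      have "dist (p + s *\<^sub>R v + t *\<^sub>R w) p \<le> norm (s *\<^sub>R v) + norm (t *\<^sub>R w)"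
        by (simp add: dist_norm add.assoc norm_triangle_ineq del: norm_scaleR)
      also have "\<dots> \<le> h * norm v + h * norm w"
        using that by (intro add_mono) (auto intro: mult_right_mono)
      also have "\<dots> \<le> h * M"
        using h by (simp add: M_def algebra_simps)
      also have "\<dots> < d"
        using M \<open>d > 0\<close> by (simp add: h_def)
      finally show ?thesis .
    qed
    obtain s t where st: "s \<in> {0..h}" "t \<in> {0..h}"
      "\<phi> (p + h *\<^sub>R v + h *\<^sub>R w) - \<phi> (p + h *\<^sub>R v) - \<phi> (p + h *\<^sub>R w) + \<phi> p
        = h * h * A (p + s *\<^sub>R v + t *\<^sub>R w) w"
      by (rule second_difference_mean_value[OF h _ assms(3) dv, of p w])
        (use near d3 in \<open>auto simp: d_def\<close>)
    have near': "dist (p + s *\<^sub>R w + t *\<^sub>R v) p < d" if "s \<in> {0..h}" "t \<in> {0..h}" for s t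
      using near[OF that(2,1)] by (simp add: add_ac)
    obtain s' t' where st': "s' \<in> {0..h}" "t' \<in> {0..h}"
      "\<phi> (p + h *\<^sub>R w + h *\<^sub>R v) - \<phi> (p + h *\<^sub>R w) - \<phi> (p + h *\<^sub>R v) + \<phi> p
        = h * h * B (p + s' *\<^sub>R w + t' *\<^sub>R v) v"
      by (rule second_difference_mean_value[OF h _ assms(3) dw, of p v])
        (use near' d3 in \<open>auto simp: d_def\<close>)
    have "h * h * A (p + s *\<^sub>R v + t *\<^sub>R w) w = h * h * B (p + s' *\<^sub>R w + t' *\<^sub>R v) v"
      unfolding st(3)[symmetric] st'(3)[symmetric] by (simp add: algebra_simps)
    then have "A (p + s *\<^sub>R v + t *\<^sub>R w) w = B (p + s' *\<^sub>R w + t' *\<^sub>R v) v"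
      using h by simp
    moreover have "dist (A (p + s *\<^sub>R v + t *\<^sub>R w) w) (A p w) < e / 2"
      using near[OF st(1,2)] by (intro d1) (simp add: d_def)
    moreover have "dist (B (p + s' *\<^sub>R w + t' *\<^sub>R v) v) (B p v) < e / 2"
      using near'[OF st'(1,2)] by (intro d2) (simp add: d_def)
    ultimately show ?thesis
      unfolding dist_real_def by linarith
  qed
  then show ?thesis
    by (metis eq_iff_diff_eq_0 less_irrefl zero_less_abs_iff)
qed

text \<open>Expanding the second argument in the finite basis writes \<open>L y u\<close> as a sum
  of coordinates of \<open>u\<close> times the functions \<open>L y b\<close>, so differentiability
  in \<open>y\<close> for each fixed \<open>b\<close> gives joint differentiability by the product
  rule.\<close>

lemma has_derivative_linear_family:
  fixes L :: "'a::real_normed_vector \<Rightarrow> 'b::euclidean_space \<Rightarrow> 'c::real_normed_vector"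
  assumes "open U" "x \<in> U"
    and lin: "\<And>y. y \<in> U \<Longrightarrow> linear (L y)"
    and d: "\<And>b. ((\<lambda>y. L y b) has_derivative L' b) (at x)"
  shows "((\<lambda>z. L (fst z) (snd z)) has_derivative (\<lambda>h. L' w (fst h) + L x (snd h))) (at (x, w))"
    and "linear (\<lambda>b. L' b h)"
proof -
  have L: "L y u = (\<Sum>b\<in>Basis. (u \<bullet> b) *\<^sub>R L y b)" if "y \<in> U" for y u
  proof -
    have "L y u = L y (\<Sum>b\<in>Basis. (u \<bullet> b) *\<^sub>R b)"
      by (simp add: euclidean_representation)
    then show ?thesis
      using lin[OF that] by (simp add: linear_sum linear_scale)
  qed
  \<comment> \<open>Differentiating the expansion for fixed \<open>u\<close> and comparing with the
    given derivative yields the same expansion for \<open>L'\<close>, hence its linearity.\<close>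
  have L': "L' u = (\<lambda>h. \<Sum>b\<in>Basis. (u \<bullet> b) *\<^sub>R L' b h)" for u
  proof -
    have "((\<lambda>y. \<Sum>b\<in>Basis. (u \<bullet> b) *\<^sub>R L y b) has_derivative
        (\<lambda>h. \<Sum>b\<in>Basis. (u \<bullet> b) *\<^sub>R L' b h)) (at x)"
      by (intro has_derivative_sum has_derivative_scaleR_right d)
    then have "((\<lambda>y. L y u) has_derivative (\<lambda>h. \<Sum>b\<in>Basis. (u \<bullet> b) *\<^sub>R L' b h)) (at x)"
      by (rule has_derivative_transform_within_open[OF _ assms(1,2)]) (metis L)
    with d[of u] show ?thesis
      by (rule has_derivative_unique)
  qed
  show "linear (\<lambda>b. L' b h)"
    by (subst L') (intro linear_compose_sum ballI linearI; simp add: algebra_simps)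
  have fst': "((\<lambda>z. L (fst z) b) has_derivative (\<lambda>h. L' b (fst h))) (at (x, w))" for b
    using has_derivative_compose[OF has_derivative_fst[OF has_derivative_ident], of "\<lambda>y. L y b" "L' b" "(x, w)"] d[of b]
    by simp
  have "((\<lambda>z. \<Sum>b\<in>Basis. (snd z \<bullet> b) *\<^sub>R L (fst z) b) has_derivative
      (\<lambda>h. \<Sum>b\<in>Basis. (w \<bullet> b) *\<^sub>R L' b (fst h) + (snd h \<bullet> b) *\<^sub>R L x b)) (at (x, w))"
    by (rule derivative_eq_intros fst' refl | simp)+
  moreover have "(\<lambda>h. \<Sum>b\<in>Basis. (w \<bullet> b) *\<^sub>R L' b (fst h) + (snd h \<bullet> b) *\<^sub>R L x b)
      = (\<lambda>h. L' w (fst h) + L x (snd h))"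
    by (simp only: sum.distrib L'[of w] L[OF assms(2), of "snd _"])
  ultimately have "((\<lambda>z. \<Sum>b\<in>Basis. (snd z \<bullet> b) *\<^sub>R L (fst z) b) has_derivative
      (\<lambda>h. L' w (fst h) + L x (snd h))) (at (x, w))"
    by simp
  then show "((\<lambda>z. L (fst z) (snd z)) has_derivative (\<lambda>h. L' w (fst h) + L x (snd h))) (at (x, w))"
    by (rule has_derivative_transform_within_open[where s = "U \<times> UNIV"])
      (use assms(1,2) in \<open>auto simp: open_Times L[symmetric]\<close>)
qed

lemma has_vector_derivative_linear_family:
  fixes L :: "'a::real_normed_vector \<Rightarrow> 'b::euclidean_space \<Rightarrow> 'c::real_normed_vector"
  assumes "open U" "\<gamma> t \<in> U"
    and "\<And>y. y \<in> U \<Longrightarrow> linear (L y)"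
    and "\<And>b. ((\<lambda>y. L y b) has_derivative L' b) (at (\<gamma> t))"
    and "(\<gamma> has_vector_derivative \<gamma>') (at t)" "(u has_vector_derivative u') (at t)"
  shows "((\<lambda>s. L (\<gamma> s) (u s)) has_vector_derivative (L' (u t) \<gamma>' + L (\<gamma> t) u')) (at t)"
proof -
  have "((\<lambda>s. (\<gamma> s, u s)) has_vector_derivative (\<gamma>', u')) (at t)"
    using assms(5,6) by (rule has_vector_derivative_Pair)
  from vector_derivative_diff_chain_within[OF this
      has_derivative_at_withinI[OF has_derivative_linear_family(1)[OF assms(1-4)]]]
  show ?thesis
    by (simp add: o_def)
qed

text \<open>The linear case is used twice: for fixed \<open>b\<close> to differentiate
  \<open>B y a b\<close> jointly in \<open>(y, a)\<close>, then with the pair \<open>(y, a)\<close>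
  as base point of a family linear in \<open>b\<close>.\<close>

lemma has_vector_derivative_bilinear_family:
  fixes B :: "'a::real_normed_vector \<Rightarrow> 'b::euclidean_space \<Rightarrow> 'b \<Rightarrow> 'c::real_normed_vector"
  assumes "open U" "\<gamma> t \<in> U"
    and lin1: "\<And>y b. y \<in> U \<Longrightarrow> linear (\<lambda>a. B y a b)"
    and lin2: "\<And>y a. y \<in> U \<Longrightarrow> linear (B y a)"
    and d: "\<And>a b. ((\<lambda>y. B y a b) has_derivative B' a b) (at (\<gamma> t))"
    and "(\<gamma> has_vector_derivative \<gamma>') (at t)" "(u has_vector_derivative u') (at t)"
  shows "((\<lambda>s. B (\<gamma> s) (u s) (u s)) has_vector_derivative
      (B' (u t) (u t) \<gamma>' + B (\<gamma> t) u' (u t) + B (\<gamma> t) (u t) u')) (at t)"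
proof -
  let ?L = "\<lambda>z. B (fst z) (snd z)"
  have 1: "((\<lambda>z. ?L z b) has_derivative (\<lambda>h. B' (u t) b (fst h) + B (\<gamma> t) (snd h) b)) (at (\<gamma> t, u t))" for b
    using has_derivative_linear_family(1)[OF assms(1,2) lin1 d] .
  show ?thesis
    using has_vector_derivative_linear_family[of "U \<times> UNIV" "\<lambda>s. (\<gamma> s, u s)" t ?L,
        OF _ _ _ 1 has_vector_derivative_Pair[OF assms(6,7)] assms(7)] assms(1,2) lin2
    by (auto simp: open_Times)
qed

text \<open>A left inverse \<open>L\<close> of \<open>A\<close> makes \<open>L \<circ> f\<close> a
  map with identity derivative at \<open>\<gamma> t\<close>. The increment of \<gamma> thus differs
  from that of the differentiable curve \<open>L \<circ> f \<circ> \<gamma>\<close> by a small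
  fraction of itself, which can be absorbed. The derivative is \<open>L c'\<close>.\<close>

lemma has_vector_derivative_lift:
  fixes f :: "'a::euclidean_space \<Rightarrow> 'b::euclidean_space"
  assumes f: "(f has_derivative A) (at (\<gamma> t))" and "inj A" and cont: "isCont \<gamma> t"
    and c: "((\<lambda>s. f (\<gamma> s)) has_vector_derivative c') (at t)"
  shows "\<exists>d. (\<gamma> has_vector_derivative d) (at t)"
proof -
  have "linear A"
    using f by (rule has_derivative_linear)
  from linear_injective_left_inverse[OF this \<open>inj A\<close>]
  obtain L where L: "linear L" "L \<circ> A = id" by blast
  then have bL: "bounded_linear L"
    by (simp add: linear_conv_bounded_linear)
  define d where "d = L c'"
  have F: "((\<lambda>y. L (f y)) has_derivative (\<lambda>h. h)) (at (\<gamma> t))"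
    using bounded_linear.has_derivative[OF bL f] L(2) by (simp add: fun_eq_iff)
  have G: "((\<lambda>s. L (f (\<gamma> s))) has_derivative (\<lambda>h. h *\<^sub>R d)) (at t)"
    using bounded_linear.has_vector_derivative[OF bL c] by (simp add: d_def has_vector_derivative_def)
  have "\<forall>\<^sub>F s in at t. norm (\<gamma> s - \<gamma> t - (s - t) *\<^sub>R d) \<le> e * norm (s - t)" if e: "e > 0" for e
  proof -
    define K where "K = norm d + e / 2"
    \<comment> \<open>The bound 1/2 absorbs the increment of \<gamma> and gives it the a priori
      bound \<open>2 * K * norm (s - t)\<close>; the other bound then makes its contribution to the
      error at most \<open>e / 2 * norm (s - t)\<close>.\<close>
    define e1 where "e1 = min (1/2) (e / (4 * K))"
    have K: "K > 0"
      using e by (simp add: K_def add_nonneg_pos)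
    have e1: "e1 > 0" "e1 \<le> 1/2" "2 * e1 * K \<le> e / 2"
      using e K by (auto simp: e1_def min_def field_simps)
    have "\<forall>\<^sub>F y in at (\<gamma> t). norm (L (f y) - L (f (\<gamma> t)) - (y - \<gamma> t)) \<le> e1 * norm (y - \<gamma> t)"
      using F e1(1) unfolding has_derivative_within_alt2 by blast
    \<comment> \<open>The curve may return to \<open>\<gamma> t\<close> at other parameters, so the
      estimate is needed at that point too, where it is trivial.\<close>
    then have "\<forall>\<^sub>F y in nhds (\<gamma> t). norm (L (f y) - L (f (\<gamma> t)) - (y - \<gamma> t)) \<le> e1 * norm (y - \<gamma> t)"
      unfolding eventually_at_filter
      by (rule eventually_mono) (metis UNIV_I diff_self norm_zero mult_zero_right order_refl)
    moreover have "filterlim \<gamma> (nhds (\<gamma> t)) (at t)"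
      using cont by (simp add: continuous_at)
    ultimately have ev1: "\<forall>\<^sub>F s in at t. norm (L (f (\<gamma> s)) - L (f (\<gamma> t)) - (\<gamma> s - \<gamma> t)) \<le> e1 * norm (\<gamma> s - \<gamma> t)"
      unfolding filterlim_iff by blast
    have ev2: "\<forall>\<^sub>F s in at t. norm (L (f (\<gamma> s)) - L (f (\<gamma> t)) - (s - t) *\<^sub>R d) \<le> e / 2 * norm (s - t)"
      using G e unfolding has_derivative_within_alt2 by (meson half_gt_zero)
    show ?thesis
      using ev1 ev2
    proof eventually_elim
      case (elim s)
      let ?D = "\<gamma> s - \<gamma> t" and ?F = "L (f (\<gamma> s)) - L (f (\<gamma> t))"
      have "norm ?D \<le> norm (?F - ?D) + norm (?F - (s - t) *\<^sub>R d) + norm ((s - t) *\<^sub>R d)"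
        using norm_triangle_ineq[of "?F - (s - t) *\<^sub>R d - (?F - ?D)" "(s - t) *\<^sub>R d"]
          norm_triangle_ineq4[of "?F - (s - t) *\<^sub>R d" "?F - ?D"] by simp
      also have "\<dots> \<le> 1/2 * norm ?D + K * norm (s - t)"
      proof -
        have "norm ((s - t) *\<^sub>R d) = norm d * norm (s - t)"
          by simp
        moreover have "K * norm (s - t) = norm d * norm (s - t) + e / 2 * norm (s - t)"
          by (simp add: K_def algebra_simps)
        ultimately show ?thesis
          using elim mult_right_mono[OF e1(2) norm_ge_zero, of ?D] by linarith
      qed
      finally have D: "norm ?D \<le> 2 * K * norm (s - t)"
        by simp
      have "norm (?D - (s - t) *\<^sub>R d) \<le> norm (?F - ?D) + norm (?F - (s - t) *\<^sub>R d)"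
        using norm_triangle_ineq4[of "?F - (s - t) *\<^sub>R d" "?F - ?D"] by (simp add: algebra_simps)
      also have "\<dots> \<le> e1 * (2 * K * norm (s - t)) + e / 2 * norm (s - t)"
        using elim mult_left_mono[OF D, of e1] e1(1) by linarith
      also have "\<dots> = (2 * e1 * K + e / 2) * norm (s - t)"
        by (simp add: algebra_simps)
      also have "\<dots> \<le> e * norm (s - t)"
        using e1(3) by (intro mult_right_mono) auto
      finally show ?case .
    qed
  qed
  then have "(\<gamma> has_vector_derivative d) (at t)"
    unfolding has_vector_derivative_def has_derivative_within_alt2
    by (auto simp: bounded_linear_scaleR_left)
  then show ?thesis ..
qed

lemma inner_const_derivative_zero:
  fixes c :: "real \<Rightarrow> 'a::real_inner"
  assumes "open I" "t \<in> I" "\<And>s. s \<in> I \<Longrightarrow> c s \<bullet> n = k" "(c has_vector_derivative c') (at t)"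
  shows "c' \<bullet> n = 0"
proof -
  have "((\<lambda>s. c s \<bullet> n) has_vector_derivative c' \<bullet> n) (at t)"
    using assms(4) bounded_linear.has_vector_derivative[OF bounded_linear_inner_left] by blast
  moreover have "((\<lambda>s. c s \<bullet> n) has_vector_derivative 0) (at t)"
    by (rule has_vector_derivative_transform_within_open[OF has_vector_derivative_const assms(1,2)])
      (simp add: assms(3))
  ultimately show ?thesis
    by (rule vector_derivative_unique_at)
qed

section \<open>The cross product\<close>

lemma bounded_bilinear_cross3: "bounded_bilinear cross3"
  using bilinear_cross bilinear_conv_bounded_bilinear by blast

lemmas has_vector_derivative_cross3 =
  bounded_bilinear.has_vector_derivative[OF bounded_bilinear_cross3]

lemma parallel_of_cross_zero:
  fixes w x :: "real^3"
  assumes "cross3 w x = 0" "w \<noteq> 0"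
  shows "x = ((w \<bullet> x) / (w \<bullet> w)) *\<^sub>R w"
proof -
  have "cross3 w (cross3 w x) = 0"
    by (simp add: assms(1))
  then have "(w \<bullet> w) *\<^sub>R x = (w \<bullet> x) *\<^sub>R w"
    by (simp add: Lagrange)
  then have "(1 / (w \<bullet> w)) *\<^sub>R ((w \<bullet> w) *\<^sub>R x) = (1 / (w \<bullet> w)) *\<^sub>R ((w \<bullet> x) *\<^sub>R w)"
    by simp
  then show ?thesis
    using assms(2) by simp
qed

text \<open>By Lagrange's formula \<open>n\<close> has zero cross product with
  \<open>cross3 a b\<close>. For tangent vectors this reduces the cross product to one signed
  number.\<close>

lemma cross_parallel_normal:
  fixes a b n :: "real^3"
  assumes "n \<bullet> n = 1" "n \<bullet> a = 0" "n \<bullet> b = 0"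
  shows "cross3 a b = (cross3 a b \<bullet> n) *\<^sub>R n"
proof -
  have "cross3 n (cross3 a b) = 0"
    by (simp add: Lagrange assms)
  moreover have "n \<noteq> 0"
    using assms(1) by auto
  ultimately show ?thesis
    using parallel_of_cross_zero[of n "cross3 a b"] assms(1) by (simp add: inner_commute)
qed

lemma norm_cross_unit_orthogonal:
  fixes n V :: "real^3"
  assumes "n \<bullet> n = 1" "n \<bullet> V = 0"
  shows "cross3 n V \<bullet> cross3 n V = V \<bullet> V" "norm (cross3 n V) = norm V"
proof -
  show "cross3 n V \<bullet> cross3 n V = V \<bullet> V"
    using assms norm_cross_dot[of n V] by (simp add: power2_norm_eq_inner power_mult_distrib)
  then show "norm (cross3 n V) = norm V"
    by (simp add: norm_eq_sqrt_inner)
qed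

section \<open>Surface patches\<close>

locale surface_patch =
  fixes U :: "(real^2) set" and f \<nu> :: "real^2 \<Rightarrow> real^3"
  assumes open_U: "open U"
    and embedding: "smooth_embedding_on U f"
    and normal: "unit_normal_field U f \<nu>"
begin

abbreviation Df where "Df x w \<equiv> frechet_derivative f (at x) w"
abbreviation D2f where "D2f x w u \<equiv> frechet_derivative (\<lambda>y. Df y w) (at x) u"
abbreviation D\<nu> where "D\<nu> x u \<equiv> frechet_derivative \<nu> (at x) u"
abbreviation II where "II \<equiv> second_fundamental_form f \<nu>"

section \<open>The fundamental forms and the shape operator\<close>

lemma smooth: "smooth_on U f" "smooth_on U (\<lambda>x. Df x w)" "smooth_on U (\<lambda>x. D2f x w u)" "smooth_on U \<nu>"
  using embedding normal
  by (auto simp: smooth_embedding_on_def unit_normal_field_def intro!: smooth_on_frechet_derivative)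

lemma has_derivative_surface:
  assumes "x \<in> U"
  shows "(f has_derivative Df x) (at x)"
    and "((\<lambda>y. Df y w) has_derivative D2f x w) (at x)"
    and "((\<lambda>y. D2f y w u) has_derivative frechet_derivative (\<lambda>y. D2f y w u) (at x)) (at x)"
    and "(\<nu> has_derivative D\<nu> x) (at x)"
  using smooth smooth_on_has_derivative assms by blast+

lemma linear_Df: "x \<in> U \<Longrightarrow> linear (Df x)"
  using has_derivative_surface(1) has_derivative_linear by blast

text \<open>In \<open>u\<close> this is the linearity of a derivative; in \<open>w\<close> it is
  inherited from the linearity of \<open>Df y\<close> for all \<open>y\<close> in
  \<open>U\<close>.\<close>

lemma linear_D2f:
  assumes "x \<in> U"
  shows "linear (D2f x w)" "linear (\<lambda>w. D2f x w u)"
  using has_derivative_surface(2)[OF assms] has_derivative_linear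
    has_derivative_linear_family(2)[OF open_U assms linear_Df has_derivative_surface(2)[OF assms]]
  by blast+

lemma linear_II:
  assumes "x \<in> U"
  shows "linear (II x w)" "linear (\<lambda>w. II x w u)"
  using linear_D2f[OF assms] unfolding second_fundamental_form_def
  by (auto simp: linear_iff inner_add_left)

lemma inj_Df: "x \<in> U \<Longrightarrow> inj (Df x)"
  using embedding by (simp add: smooth_embedding_on_def)

lemma Df_eq_0_iff: "x \<in> U \<Longrightarrow> Df x w = 0 \<longleftrightarrow> w = 0"
  using linear_injective_0 linear_Df inj_Df linear_0 by metis

lemma normal_unit: "x \<in> U \<Longrightarrow> \<nu> x \<bullet> \<nu> x = 1"
  using normal by (simp add: unit_normal_field_def norm_eq_1)

lemma normal_Df: "x \<in> U \<Longrightarrow> \<nu> x \<bullet> Df x w = 0"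
  using normal by (simp add: unit_normal_field_def)

lemma inner_derivative_zero:
  assumes "x \<in> U" "\<And>y. y \<in> U \<Longrightarrow> g y \<bullet> h y = (k::real)"
    and "(g has_derivative g') (at x)" "(h has_derivative h') (at x)"
  shows "g x \<bullet> h' u + g' u \<bullet> h x = 0"
proof -
  have "((\<lambda>y. g y \<bullet> h y) has_derivative (\<lambda>u. g x \<bullet> h' u + g' u \<bullet> h x)) (at x)"
    by (rule has_derivative_inner[OF assms(3,4)])
  moreover have "((\<lambda>y. g y \<bullet> h y) has_derivative (\<lambda>u. 0)) (at x)"
    by (rule has_derivative_transform_within_open[OF has_derivative_const open_U assms(1)])
      (simp add: assms(2))
  ultimately have "(\<lambda>u. g x \<bullet> h' u + g' u \<bullet> h x) = (\<lambda>u. 0)"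
    by (rule has_derivative_unique)
  then show ?thesis
    by (rule fun_cong)
qed

text \<open>Weingarten's equation: the relation \<open>\<nu> y \<bullet> Df y w = 0\<close> is
  differentiated in direction \<open>u\<close>.\<close>

lemma II_eq_shape:
  assumes "x \<in> U"
  shows "II x w u = - (D\<nu> x u \<bullet> Df x w)"
  using inner_derivative_zero[OF assms normal_Df has_derivative_surface(4)[OF assms]
      has_derivative_surface(2)[OF assms], of w u]
  by (simp add: second_fundamental_form_def inner_commute)

lemma normal_D\<nu>: "x \<in> U \<Longrightarrow> D\<nu> x u \<bullet> \<nu> x = 0"
  using inner_derivative_zero[OF _ normal_unit has_derivative_surface(4) has_derivative_surface(4), of x u]
  by (simp add: inner_commute)

text \<open>With the normal frozen at \<open>x\<close>, both sides are mixed second derivatives of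
  the scalar function \<open>f y \<bullet> \<nu> x\<close> of \<open>y\<close>.\<close>

lemma II_sym:
  assumes "x \<in> U"
  shows "II x w u = II x u w"
proof -
  have inner: "((\<lambda>y. g y \<bullet> n) has_derivative (\<lambda>h. g' h \<bullet> n)) (at y)"
    if "(g has_derivative g') (at y)" for g g' y and n :: "real^3"
    using that by (rule has_derivative_inner_left)
  have cont: "isCont (\<lambda>y. D2f y a b \<bullet> \<nu> x) x" for a b
    using smooth_on_continuous_on[OF smooth(3)] open_U assms
    by (intro isCont_inner) (auto simp: continuous_on_eq_continuous_at)
  have "D2f x w u \<bullet> \<nu> x = D2f x u w \<bullet> \<nu> x"
    by (rule second_derivative_symmetric[where \<phi>' = "\<lambda>y a. Df y a \<bullet> \<nu> x"
          and A = "\<lambda>y a. D2f y w a \<bullet> \<nu> x" and B = "\<lambda>y a. D2f y u a \<bullet> \<nu> x",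
          OF open_U assms inner inner inner cont cont])
      (rule has_derivative_surface(1,2), assumption)+
  then show ?thesis
    by (simp add: second_fundamental_form_def)
qed

section \<open>The coordinate frame and the Gaussian curvature\<close>

abbreviation "X1 x \<equiv> Df x (axis 1 1)"
abbreviation "X2 x \<equiv> Df x (axis 2 1)"

lemma vec2_expansion: "w = w $ 1 *\<^sub>R axis 1 1 + w $ 2 *\<^sub>R axis 2 1" for w :: "real^2"
  by (simp add: vec_eq_iff forall_2 axis_def)

lemma Df_expansion:
  assumes "x \<in> U"
  shows "Df x w = w $ 1 *\<^sub>R X1 x + w $ 2 *\<^sub>R X2 x"
proof -
  have "Df x w = Df x (w $ 1 *\<^sub>R axis 1 1 + w $ 2 *\<^sub>R axis 2 1)"
    by (rule arg_cong[OF vec2_expansion])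
  then show ?thesis
    using linear_Df[OF assms] by (simp only: linear_add linear_scale)
qed

text \<open>The coefficient is the signed area density of \<open>f\<close>: its square is the
  determinant of the first fundamental form, and it is the denominator when tangent vectors are
  resolved along \<open>X1\<close> and \<open>X2\<close>.\<close>

lemma cross_partials:
  assumes "x \<in> U"
  shows "cross3 (X1 x) (X2 x) = (cross3 (X1 x) (X2 x) \<bullet> \<nu> x) *\<^sub>R \<nu> x"
    and "cross3 (X1 x) (X2 x) \<bullet> \<nu> x \<noteq> 0"
proof -
  show par: "cross3 (X1 x) (X2 x) = (cross3 (X1 x) (X2 x) \<bullet> \<nu> x) *\<^sub>R \<nu> x"
    using cross_parallel_normal normal_unit normal_Df assms by blast
  show "cross3 (X1 x) (X2 x) \<bullet> \<nu> x \<noteq> 0"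
  proof
    assume "cross3 (X1 x) (X2 x) \<bullet> \<nu> x = 0"
    then have "cross3 (X1 x) (cross3 (X1 x) (X2 x)) = 0"
      using par by simp
    then have "(X1 x \<bullet> X2 x) *\<^sub>R X1 x - (X1 x \<bullet> X1 x) *\<^sub>R X2 x = 0"
      by (simp add: Lagrange)
    \<comment> \<open>If the partials were parallel, \<open>Df x\<close> would kill this vector.
      Injectivity makes the vector zero, so its second coordinate forces \<open>X1 x\<close> to
      vanish, again against injectivity.\<close>
    then have "Df x ((X1 x \<bullet> X2 x) *\<^sub>R axis 1 1 - (X1 x \<bullet> X1 x) *\<^sub>R axis 2 1) = 0"
      using linear_Df[OF assms] by (simp add: linear_diff linear_scale)
    then have "(X1 x \<bullet> X2 x) *\<^sub>R axis 1 1 - (X1 x \<bullet> X1 x) *\<^sub>R axis 2 1 = (0 :: real^2)"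
      using Df_eq_0_iff[OF assms] by blast
    then have "X1 x \<bullet> X1 x = 0"
      by (simp add: vec_eq_iff forall_2 axis_def)
    then have "axis 1 1 = (0 :: real^2)"
      using Df_eq_0_iff[OF assms] by simp
    then show False
      by simp
  qed
qed

text \<open>\<open>m\<close> is the asymptotic torsion, so \<open>K = - m\<^sup>2\<close> is the Beltrami--Enneper theorem.\<close>

lemma asymptotic_direction_shape:
  assumes "p \<in> U" "asymptotic_direction f \<nu> p v"
  obtains m where "D\<nu> p v = - m *\<^sub>R cross3 (\<nu> p) (Df p v)" "gaussian_curvature f \<nu> p = - m\<^sup>2"
proof -
  let ?V = "Df p v" and ?a = "X1 p" and ?b = "X2 p"
  let ?w = "cross3 (\<nu> p) ?V"
  define m where "m = - (?w \<bullet> D\<nu> p v) / (?w \<bullet> ?w)"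
  have v: "v \<noteq> 0" "II p v v = 0"
    using assms(2) by (auto simp: asymptotic_direction_def)
  have "D\<nu> p v \<bullet> ?V = 0"
    using II_eq_shape[OF assms(1), of v v] v(2) by simp
  \<comment> \<open>Since \<open>D\<nu> p v\<close> is orthogonal to both \<open>\<nu> p\<close> and
    \<open>?V\<close>, Lagrange's formula makes its cross product with \<open>?w\<close>
    vanish.\<close>
  then have "cross3 ?w (D\<nu> p v) = 0"
    using Lagrange[of "D\<nu> p v" "\<nu> p" ?V] normal_D\<nu>[OF assms(1), of v] cross_skew[of ?w] by simp
  moreover have "?w \<noteq> 0"
    using norm_cross_unit_orthogonal(1)[OF normal_unit normal_Df, OF assms(1,1), of v]
      Df_eq_0_iff[OF assms(1), of v] v(1) by auto
  ultimately have m: "D\<nu> p v = - m *\<^sub>R ?w"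
    using parallel_of_cross_zero[of ?w "D\<nu> p v"] by (simp add: m_def)
  define J where "J = cross3 ?a ?b \<bullet> \<nu> p"
  define L M N where "L = II p (axis 1 1) (axis 1 1)" and "M = II p (axis 1 1) (axis 2 1)"
    and "N = II p (axis 2 1) (axis 2 1)"
  have IIv: "II p w v = m * (cross3 ?V (Df p w) \<bullet> \<nu> p)" for w
    using cross_triple[of "\<nu> p" ?V "Df p w"] by (simp add: II_eq_shape[OF assms(1)] m)
  have exp: "II p w v = v $ 1 * II p w (axis 1 1) + v $ 2 * II p w (axis 2 1)" for w
  proof -
    have "II p w v = II p w (v $ 1 *\<^sub>R axis 1 1 + v $ 2 *\<^sub>R axis 2 1)"
      by (rule arg_cong[OF vec2_expansion])
    then show ?thesis
      using linear_II(1)[OF assms(1), of w] by (simp only: linear_add linear_scale real_scaleR_def)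
  qed
  have V: "?V = v $ 1 *\<^sub>R ?a + v $ 2 *\<^sub>R ?b"
    by (rule Df_expansion[OF assms(1)])
  have 1: "v $ 1 * L + v $ 2 * M = - m * v $ 2 * J"
    using IIv[of "axis 1 1"] exp[of "axis 1 1"] cross_skew[of ?b ?a]
    by (simp add: L_def M_def J_def V cross_add_left cross_mult_left)
  have 2: "v $ 1 * M + v $ 2 * N = m * v $ 1 * J"
    using IIv[of "axis 2 1"] exp[of "axis 2 1"] II_sym[OF assms(1), of "axis 2 1" "axis 1 1"]
    by (simp add: N_def M_def J_def V cross_add_left cross_mult_left)
  \<comment> \<open>The two equations say that the matrix of the second fundamental form sends
    \<open>v\<close> to \<open>m * J\<close> times \<open>v\<close> turned by a right angle.
    Multiplying by a non-zero coordinate of \<open>v\<close> lets the determinant be read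
    off.\<close>
  have det: "L * N - M * M = - m\<^sup>2 * J\<^sup>2"
  proof (cases "v $ 1 = 0")
    case True
    then have "v $ 2 \<noteq> 0"
      using v(1) by (auto simp: vec_eq_iff forall_2)
    moreover have "v $ 2 * (L * N - M * M) = v $ 2 * (- m\<^sup>2 * J\<^sup>2)"
      using 1 2 by algebra
    ultimately show ?thesis
      by (metis mult_left_cancel)
  next
    case False
    moreover have "v $ 1 * (L * N - M * M) = v $ 1 * (- m\<^sup>2 * J\<^sup>2)"
      using 1 2 by algebra
    ultimately show ?thesis
      by (metis mult_left_cancel)
  qed
  \<comment> \<open>This is the determinant of the first fundamental form, so \<open>J\<close>
    cancels in the Gaussian curvature.\<close>
  have "J\<^sup>2 = cross3 ?a ?b \<bullet> cross3 ?a ?b"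
    using cross_partials(1)[OF assms(1)] normal_unit[OF assms(1)]
    by (metis J_def inner_scaleR_left inner_scaleR_right mult.right_neutral power2_eq_square)
  also have "\<dots> = (?a \<bullet> ?a) * (?b \<bullet> ?b) - (?a \<bullet> ?b) * (?a \<bullet> ?b)"
    using norm_cross_dot[of ?a ?b]
    by (simp add: power2_norm_eq_inner power_mult_distrib power2_eq_square[of "?a \<bullet> ?b"])
  finally have "gaussian_curvature f \<nu> p = (- m\<^sup>2 * J\<^sup>2) / J\<^sup>2"
    using det II_sym[OF assms(1), of "axis 2 1" "axis 1 1"]
    by (simp add: gaussian_curvature_def det_2 first_fundamental_form_def L_def M_def N_def inner_commute)
  then have "gaussian_curvature f \<nu> p = - m\<^sup>2"
    using cross_partials(2)[OF assms(1)] by (simp add: J_def)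
  with m show thesis
    by (rule that)
qed

section \<open>Derivatives of curves on the surface\<close>

lemma curve_on_surface:
  assumes "\<gamma> t \<in> U" "(\<gamma> has_vector_derivative \<gamma>') (at t)" "(w has_vector_derivative w') (at t)"
  shows "((\<lambda>s. f (\<gamma> s)) has_vector_derivative Df (\<gamma> t) \<gamma>') (at t)"
    and "((\<lambda>s. \<nu> (\<gamma> s)) has_vector_derivative D\<nu> (\<gamma> t) \<gamma>') (at t)"
    and "((\<lambda>s. Df (\<gamma> s) (w s)) has_vector_derivative D2f (\<gamma> t) (w t) \<gamma>' + Df (\<gamma> t) w') (at t)"
proof -
  show "((\<lambda>s. f (\<gamma> s)) has_vector_derivative Df (\<gamma> t) \<gamma>') (at t)"
    and "((\<lambda>s. \<nu> (\<gamma> s)) has_vector_derivative D\<nu> (\<gamma> t) \<gamma>') (at t)"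
    using vector_derivative_diff_chain_within[OF assms(2)
        has_derivative_at_withinI[OF has_derivative_surface(1)[OF assms(1)]]]
      vector_derivative_diff_chain_within[OF assms(2)
        has_derivative_at_withinI[OF has_derivative_surface(4)[OF assms(1)]]]
    by (simp_all add: o_def)
  show "((\<lambda>s. Df (\<gamma> s) (w s)) has_vector_derivative D2f (\<gamma> t) (w t) \<gamma>' + Df (\<gamma> t) w') (at t)"
    by (rule has_vector_derivative_linear_family[where L' = "D2f (\<gamma> t)" and L = Df,
          OF open_U assms(1) linear_Df has_derivative_surface(2)[OF assms(1)] assms(2,3)])
qed

text \<open>
  In terms of the flat derivatives of \<open>f\<close> this is \<open>D\<^sup>3f(v, v, v) \<bullet> \<nu> + 3 (D\<nu>(v) \<bullet> D\<^sup>2f(v, v))\<close>, the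
  number \<open>T\<close> of the introduction.
\<close>

definition third_order :: "real^2 \<Rightarrow> real^2 \<Rightarrow> real" where
  "third_order p v = frechet_derivative (\<lambda>y. II y v v) (at p) v + 2 * (D\<nu> p v \<bullet> D2f p v v)"

text \<open>The first formula is the product rule for II along the curve. The second follows because
  \<open>c2 \<bullet> \<nu>\<close> equals II along the curve: its derivative is also
  \<open>c3 \<bullet> \<nu>\<close> plus \<open>l * (D\<nu> p v \<bullet> c2 0)\<close>. The
  derivatives of \<gamma> are arbitrary functions so that the lemma applies also to lifted curves,
  which are only known to be twice differentiable.\<close>

lemma third_derivative_normal_part:
  assumes I: "open I" "0 \<in> I" "\<gamma> ` I \<subseteq> U"
    and \<gamma>: "\<And>t. t \<in> I \<Longrightarrow> (\<gamma> has_vector_derivative \<gamma>1 t) (at t)"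
      "(\<gamma>1 has_vector_derivative \<gamma>2 0) (at 0)"
    and c2: "\<And>t. t \<in> I \<Longrightarrow> c2 t = D2f (\<gamma> t) (\<gamma>1 t) (\<gamma>1 t) + Df (\<gamma> t) (\<gamma>2 t)"
    and c3: "(c2 has_vector_derivative c3) (at 0)"
    and p: "\<gamma> 0 = p" "\<gamma>1 0 = l *\<^sub>R v"
  shows "((\<lambda>t. II (\<gamma> t) (\<gamma>1 t) (\<gamma>1 t)) has_vector_derivative
      l ^ 3 * third_order p v - 2 * l * (D\<nu> p v \<bullet> c2 0)) (at 0)"
    and "c3 \<bullet> \<nu> p = l ^ 3 * third_order p v - 3 * l * (D\<nu> p v \<bullet> c2 0)"
proof -
  have pU: "p \<in> U"
    using I p by auto
  have \<gamma>0: "\<gamma> 0 \<in> U"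
    using pU p by simp
  have dII: "((\<lambda>y. II y a b) has_derivative frechet_derivative (\<lambda>y. II y a b) (at p)) (at p)" for a b
  proof -
    have "((\<lambda>y. II y a b) has_derivative (\<lambda>h. D2f p a b \<bullet> D\<nu> p h +
        frechet_derivative (\<lambda>y. D2f y a b) (at p) h \<bullet> \<nu> p)) (at p)"
      unfolding second_fundamental_form_def
      using has_derivative_surface[OF pU] by (intro has_derivative_inner)
    then show ?thesis
      using differentiableI frechet_derivative_works by blast
  qed
  let ?E = "\<lambda>a. frechet_derivative (\<lambda>y. II y a a) (at p)"
  \<comment> \<open>Degree two in the arguments of II and degree one in the direction of
    differentiation together give the factor l^3.\<close>
  have "((\<lambda>y. l\<^sup>2 * II y v v) has_derivative (\<lambda>h. l\<^sup>2 * ?E v h)) (at p)"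
    by (intro has_derivative_mult_right dII)
  then have "((\<lambda>y. II y (l *\<^sub>R v) (l *\<^sub>R v)) has_derivative (\<lambda>h. l\<^sup>2 * ?E v h)) (at p)"
    by (rule has_derivative_transform_within_open[OF _ open_U pU])
      (simp add: linear_scale[OF linear_II(1)] linear_scale[OF linear_II(2)] power2_eq_square)
  from fun_cong[OF frechet_derivative_at[OF this], symmetric]
  have E: "?E (l *\<^sub>R v) h = l\<^sup>2 * ?E v h" for h .
  have El: "?E (l *\<^sub>R v) (l *\<^sub>R v) = l ^ 3 * ?E v v"
    using linear_scale[OF has_derivative_linear[OF dII[of v v]], of l v]
    by (simp add: E power2_eq_square power3_eq_cube)
  have lin\<nu>: "D\<nu> p (l *\<^sub>R v) = l *\<^sub>R D\<nu> p v"
    using has_derivative_linear[OF has_derivative_surface(4)[OF pU]] by (rule linear_scale)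
  have c20: "c2 0 = l\<^sup>2 *\<^sub>R D2f p v v + Df p (\<gamma>2 0)"
    using c2[OF I(2)] p
    by (simp add: linear_scale[OF linear_D2f(1)[OF pU]] linear_scale[OF linear_D2f(2)[OF pU]] power2_eq_square)
  \<comment> \<open>Solving \<open>c20\<close> for \<open>Df p (\<gamma>2 0)\<close> trades the
    acceleration in the parameter domain for the acceleration in space.\<close>
  have "II p (\<gamma>2 0) (l *\<^sub>R v) = - l * (D\<nu> p v \<bullet> (c2 0 - l\<^sup>2 *\<^sub>R D2f p v v))"
    by (simp add: II_eq_shape[OF pU] lin\<nu> c20)
  then have II2: "II p (\<gamma>2 0) (l *\<^sub>R v) + II p (l *\<^sub>R v) (\<gamma>2 0)
      = - 2 * l * (D\<nu> p v \<bullet> c2 0) + 2 * l ^ 3 * (D\<nu> p v \<bullet> D2f p v v)"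
    by (simp add: II_sym[OF pU, of "l *\<^sub>R v"] inner_diff_right algebra_simps power2_eq_square power3_eq_cube)
  have "((\<lambda>t. II (\<gamma> t) (\<gamma>1 t) (\<gamma>1 t)) has_vector_derivative
      (?E (\<gamma>1 0) (\<gamma>1 0) + II (\<gamma> 0) (\<gamma>2 0) (\<gamma>1 0) + II (\<gamma> 0) (\<gamma>1 0) (\<gamma>2 0))) (at 0)"
    by (rule has_vector_derivative_bilinear_family[where B = II and \<gamma> = \<gamma> and u = \<gamma>1
          and B' = "\<lambda>a b. frechet_derivative (\<lambda>y. II y a b) (at p)", OF open_U \<gamma>0])
      (use linear_II dII p \<gamma>(1)[OF I(2)] \<gamma>(2) I in auto)
  moreover have "?E (\<gamma>1 0) (\<gamma>1 0) + II (\<gamma> 0) (\<gamma>2 0) (\<gamma>1 0) + II (\<gamma> 0) (\<gamma>1 0) (\<gamma>2 0)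
      = l ^ 3 * third_order p v - 2 * l * (D\<nu> p v \<bullet> c2 0)"
    using II2 by (simp add: p El third_order_def algebra_simps)
  ultimately show Q: "((\<lambda>t. II (\<gamma> t) (\<gamma>1 t) (\<gamma>1 t)) has_vector_derivative
      l ^ 3 * third_order p v - 2 * l * (D\<nu> p v \<bullet> c2 0)) (at 0)"
    by simp
  have "((\<lambda>t. c2 t \<bullet> \<nu> (\<gamma> t)) has_vector_derivative
      (c2 0 \<bullet> D\<nu> (\<gamma> 0) (\<gamma>1 0) + c3 \<bullet> \<nu> (\<gamma> 0))) (at 0)"
    by (rule bounded_bilinear.has_vector_derivative[OF bounded_bilinear_inner c3
          curve_on_surface(2)[OF \<gamma>0 \<gamma>(1)[OF I(2)] \<gamma>(2)]])
  then have "((\<lambda>t. II (\<gamma> t) (\<gamma>1 t) (\<gamma>1 t)) has_vector_derivative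
      (c2 0 \<bullet> D\<nu> (\<gamma> 0) (\<gamma>1 0) + c3 \<bullet> \<nu> (\<gamma> 0))) (at 0)"
    by (rule has_vector_derivative_transform_within_open[OF _ I(1,2)])
      (use I normal_Df in \<open>auto simp: c2 second_fundamental_form_def inner_add_left inner_commute[of "Df _ _"]\<close>)
  from vector_derivative_unique_at[OF this Q]
  show "c3 \<bullet> \<nu> p = l ^ 3 * third_order p v - 3 * l * (D\<nu> p v \<bullet> c2 0)"
    by (simp add: p lin\<nu> inner_commute algebra_simps)
qed

text \<open>The third derivative is only shown to exist: its normal component is supplied by
  \<open>third_derivative_normal_part\<close>, so no formula for it is recorded.\<close>

lemma composite_curve:
  assumes "open I" "0 \<in> I" "smooth_on I \<gamma>" "\<gamma> ` I \<subseteq> U"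
  defines "\<gamma>1 \<equiv> curve_deriv 1 \<gamma>" and "\<gamma>2 \<equiv> curve_deriv 2 \<gamma>"
  defines "c2 \<equiv> \<lambda>t. D2f (\<gamma> t) (\<gamma>1 t) (\<gamma>1 t) + Df (\<gamma> t) (\<gamma>2 t)"
  shows "\<And>t. t \<in> I \<Longrightarrow> (f \<circ> \<gamma> has_vector_derivative Df (\<gamma> t) (\<gamma>1 t)) (at t)"
    and "\<And>t. t \<in> I \<Longrightarrow> ((\<lambda>t. Df (\<gamma> t) (\<gamma>1 t)) has_vector_derivative c2 t) (at t)"
    and "(c2 has_vector_derivative curve_deriv 3 (f \<circ> \<gamma>) 0) (at 0)"
    and "\<And>t. t \<in> I \<Longrightarrow> curve_deriv 1 (f \<circ> \<gamma>) t = Df (\<gamma> t) (\<gamma>1 t)"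
    and "\<And>t. t \<in> I \<Longrightarrow> curve_deriv 2 (f \<circ> \<gamma>) t = c2 t"
proof -
  have \<gamma>: "(\<gamma> has_vector_derivative \<gamma>1 t) (at t)" "(\<gamma>1 has_vector_derivative \<gamma>2 t) (at t)"
    "(\<gamma>2 has_vector_derivative curve_deriv 3 \<gamma> t) (at t)" "\<gamma> t \<in> U" if "t \<in> I" for t
    using curve_deriv_has_vector_derivative[OF assms(3,1) that] assms(4) that
    by (auto simp: \<gamma>1_def \<gamma>2_def simp del: One_nat_def)
  show c1: "(f \<circ> \<gamma> has_vector_derivative Df (\<gamma> t) (\<gamma>1 t)) (at t)" if "t \<in> I" for t
    using curve_on_surface(1)[OF \<gamma>(4,1,2)[OF that]] by (simp add: o_def)
  show c2: "((\<lambda>t. Df (\<gamma> t) (\<gamma>1 t)) has_vector_derivative c2 t) (at t)" if "t \<in> I" for t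
    unfolding c2_def by (rule curve_on_surface(3)[OF \<gamma>(4,1,2)[OF that]])
  have "((\<lambda>t. D2f (\<gamma> t) (\<gamma>1 t) (\<gamma>1 t)) has_vector_derivative
      frechet_derivative (\<lambda>y. D2f y (\<gamma>1 0) (\<gamma>1 0)) (at (\<gamma> 0)) (\<gamma>1 0)
        + D2f (\<gamma> 0) (\<gamma>2 0) (\<gamma>1 0) + D2f (\<gamma> 0) (\<gamma>1 0) (\<gamma>2 0)) (at 0)"
    by (rule has_vector_derivative_bilinear_family[OF open_U \<gamma>(4) linear_D2f(2,1)
          has_derivative_surface(3)[OF \<gamma>(4)] \<gamma>(1,2)]) (rule assms(2) | assumption)+
  from has_vector_derivative_add[OF this curve_on_surface(3)[OF \<gamma>(4,1,3)[OF assms(2)]]]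
  obtain c3 where c3: "(c2 has_vector_derivative c3) (at 0)"
    unfolding c2_def by blast
  show "(c2 has_vector_derivative curve_deriv 3 (f \<circ> \<gamma>) 0) (at 0)"
    using c3 by (simp only: curve_deriv_eqI(3)[OF assms(1,2) c1 c2 c3])
  show "curve_deriv 1 (f \<circ> \<gamma>) t = Df (\<gamma> t) (\<gamma>1 t)" "curve_deriv 2 (f \<circ> \<gamma>) t = c2 t" if "t \<in> I" for t
    by (rule curve_deriv_eqI(1,2)[OF assms(1,2) c1 c2 c3 that]; assumption)+
qed

section \<open>The invariants of an asymptotic direction\<close>

text \<open>The normal section is given as a curve in space and has to be pulled back to
  \<open>U\<close>. The inverse of the embedding is only continuous, so differentiability of the
  lift is regained one order at a time, first from the injectivity of \<open>Df\<close>.\<close>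

lemma lift_curve:
  assumes "open I" "c ` I \<subseteq> f ` U"
    and c: "\<And>t. t \<in> I \<Longrightarrow> (c has_vector_derivative c1 t) (at t)"
      "\<And>t. t \<in> I \<Longrightarrow> (c1 has_vector_derivative c2 t) (at t)"
  obtains \<gamma> \<gamma>1 \<gamma>2 where "\<gamma> ` I \<subseteq> U" "\<And>t. t \<in> I \<Longrightarrow> f (\<gamma> t) = c t"
    "\<And>t. t \<in> I \<Longrightarrow> (\<gamma> has_vector_derivative \<gamma>1 t) (at t)"
    "\<And>t. t \<in> I \<Longrightarrow> (\<gamma>1 has_vector_derivative \<gamma>2 t) (at t)"
proof -
  obtain g where g: "homeomorphism U (f ` U) f g"
    using embedding by (auto simp: smooth_embedding_on_def)
  define \<gamma> where "\<gamma> = g \<circ> c"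
  have \<gamma>U: "\<gamma> t \<in> U" and f\<gamma>: "f (\<gamma> t) = c t" if "t \<in> I" for t
    using g assms(2) that by (auto simp: \<gamma>_def homeomorphism_def)
  have "continuous_on I c"
    using c(1) has_vector_derivative_continuous continuous_at_imp_continuous_on by blast
  then have "continuous_on I \<gamma>"
    unfolding \<gamma>_def using g assms(2)
    by (intro continuous_on_compose) (auto simp: homeomorphism_def intro: continuous_on_subset)
  then have cont: "isCont \<gamma> t" if "t \<in> I" for t
    using assms(1) that continuous_on_eq_continuous_at by blast
  have f\<gamma>1: "((\<lambda>s. f (\<gamma> s)) has_vector_derivative c1 t) (at t)" if "t \<in> I" for t
    using c(1)[OF that] assms(1) that
    by (rule has_vector_derivative_transform_within_open) (simp add: f\<gamma>)
  have "\<exists>d. (\<gamma> has_vector_derivative d) (at t)" if "t \<in> I" for t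
    by (rule has_vector_derivative_lift[OF has_derivative_surface(1)[OF \<gamma>U]
          inj_Df[OF \<gamma>U] cont f\<gamma>1]) (fact that)+
  then obtain \<gamma>1 where \<gamma>1: "\<And>t. t \<in> I \<Longrightarrow> (\<gamma> has_vector_derivative \<gamma>1 t) (at t)"
    by metis
  let ?J = "\<lambda>t. cross3 (X1 (\<gamma> t)) (X2 (\<gamma> t)) \<bullet> \<nu> (\<gamma> t)"
  let ?h = "\<lambda>t. ((cross3 (c1 t) (X2 (\<gamma> t)) \<bullet> \<nu> (\<gamma> t)) / ?J t) *\<^sub>R axis 1 1
    + ((cross3 (X1 (\<gamma> t)) (c1 t) \<bullet> \<nu> (\<gamma> t)) / ?J t) *\<^sub>R (axis 2 1 :: real^2)"
  \<comment> \<open>Cramer's rule for \<open>df (\<gamma>') = c'\<close>; it shows that \<open>\<gamma>'\<close> is differentiable again.\<close>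
  have h: "\<gamma>1 t = ?h t" if t: "t \<in> I" for t
  proof -
    have "c1 t = Df (\<gamma> t) (\<gamma>1 t)"
      using vector_derivative_unique_at[OF f\<gamma>1[OF t] curve_on_surface(1)[OF \<gamma>U[OF t] \<gamma>1[OF t] \<gamma>1[OF t]]] .
    then have "c1 t = \<gamma>1 t $ 1 *\<^sub>R X1 (\<gamma> t) + \<gamma>1 t $ 2 *\<^sub>R X2 (\<gamma> t)"
      by (rule trans[OF _ Df_expansion[OF \<gamma>U[OF t]]])
    then have "cross3 (c1 t) (X2 (\<gamma> t)) \<bullet> \<nu> (\<gamma> t) = \<gamma>1 t $ 1 * ?J t"
      "cross3 (X1 (\<gamma> t)) (c1 t) \<bullet> \<nu> (\<gamma> t) = \<gamma>1 t $ 2 * ?J t"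
      by (simp_all add: cross_add_left cross_add_right cross_mult_left cross_mult_right)
    then have "?h t = \<gamma>1 t $ 1 *\<^sub>R axis 1 1 + \<gamma>1 t $ 2 *\<^sub>R axis 2 1"
      using cross_partials(2)[OF \<gamma>U[OF t]] by simp
    from trans[OF vec2_expansion this[symmetric]] show ?thesis .
  qed
  have diff: "\<exists>d. (\<gamma>1 has_vector_derivative d) (at t)" if t: "t \<in> I" for t
  proof -
    note \<nu>' = curve_on_surface(2)[OF \<gamma>U[OF t] \<gamma>1[OF t] \<gamma>1[OF t]]
    note X' = curve_on_surface(3)[OF \<gamma>U[OF t] \<gamma>1[OF t] has_vector_derivative_const]
    \<comment> \<open>The numerators and the denominator of \<open>?h\<close> all have this form,
      with \<open>c1\<close> or a partial derivative along \<gamma> in each of the first two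
      places.\<close>
    have triple: "(\<lambda>s. cross3 (a s) (b s) \<bullet> \<nu> (\<gamma> s)) differentiable at t"
      if "(a has_vector_derivative a') (at t)" "(b has_vector_derivative b') (at t)" for a b a' b'
      using bounded_bilinear.has_vector_derivative[OF bounded_bilinear_inner
          has_vector_derivative_cross3[OF that] \<nu>'] differentiableI_vector by blast
    have "?h differentiable at t"
      using cross_partials(2)[OF \<gamma>U[OF t]]
      by (intro differentiable_add differentiable_scaleR differentiable_divide differentiable_const
          triple[OF X' X'] triple[OF c(2)[OF t] X'] triple[OF X' c(2)[OF t]])
    then obtain d where "(?h has_vector_derivative d) (at t)"
      using vector_derivative_works by blast
    then have "(\<gamma>1 has_vector_derivative d) (at t)"
      by (rule has_vector_derivative_transform_within_open[OF _ assms(1) t]) (simp only: h)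
    then show ?thesis ..
  qed
  then obtain \<gamma>2 where "\<And>t. t \<in> I \<Longrightarrow> (\<gamma>1 has_vector_derivative \<gamma>2 t) (at t)"
    by metis
  then show thesis
    using that[of \<gamma> \<gamma>1 \<gamma>2] \<gamma>U f\<gamma> \<gamma>1 by blast
qed

section \<open>The invariants expressed through \<open>third_order\<close>\<close>

lemma inj_on_surface: "inj_on f U"
  using embedding unfolding smooth_embedding_on_def homeomorphism_def by (metis inj_on_def)

text \<open>All derivatives of a curve in the tangent plane are orthogonal to
  \<open>\<nu> p\<close>, so the formula for the third derivative with l = 1 has left side zero. The
  remaining term \<open>D\<nu> p v \<bullet> c''\<close> is \<open>- m\<close> times the numerator
  of \<alpha>, as the velocity is \<open>Df p v\<close>.\<close>

lemma horizontal_curvature_third_order: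
  assumes "p \<in> U" "v \<noteq> 0"
    and m: "D\<nu> p v = - m *\<^sub>R cross3 (\<nu> p) (Df p v)"
    and "has_horizontal_curvature U f \<nu> p v \<alpha>"
  shows "3 * m * \<alpha> * norm (Df p v) ^ 3 = - third_order p v"
proof -
  obtain I \<sigma> where I: "open I" "0 \<in> I" "smooth_on I \<sigma>" "\<sigma> ` I \<subseteq> U"
    and \<sigma>0: "\<sigma> 0 = p" "curve_deriv 1 \<sigma> 0 = v"
    and tangent: "(f \<circ> \<sigma>) ` I \<subseteq> tangent_plane f \<nu> p"
    and \<alpha>: "\<alpha> = plane_curvature (\<nu> p) (f \<circ> \<sigma>) 0"
    using assms(4) unfolding has_horizontal_curvature_def regular_curve_on_def by blast
  let ?c1 = "\<lambda>t. Df (\<sigma> t) (curve_deriv 1 \<sigma> t)"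
  let ?c2 = "\<lambda>t. D2f (\<sigma> t) (curve_deriv 1 \<sigma> t) (curve_deriv 1 \<sigma> t) + Df (\<sigma> t) (curve_deriv 2 \<sigma> t)"
  let ?c3 = "curve_deriv 3 (f \<circ> \<sigma>) 0"
  note c = composite_curve[OF I]
  note d\<sigma> = curve_deriv_has_vector_derivative[OF I(3,1)]
  have c0: "(f \<circ> \<sigma>) t \<bullet> \<nu> p = f p \<bullet> \<nu> p" if "t \<in> I" for t
    using tangent that by (auto simp: tangent_plane_def inner_diff_left)
  have c1: "?c1 t \<bullet> \<nu> p = 0" if "t \<in> I" for t
    using inner_const_derivative_zero[OF I(1) that c0 c(1)[OF that]] .
  have c2: "?c2 t \<bullet> \<nu> p = 0" if "t \<in> I" for t
    using inner_const_derivative_zero[OF I(1) that c1 c(2)[OF that]] .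
  have "?c3 \<bullet> \<nu> p = 0"
    using inner_const_derivative_zero[OF I(1,2) c2 c(3)] .
  moreover have "?c3 \<bullet> \<nu> p = 1 ^ 3 * third_order p v - 3 * 1 * (D\<nu> p v \<bullet> ?c2 0)"
    by (rule third_derivative_normal_part(2)[OF I(1,2,4) d\<sigma>(1,2) refl c(3) \<sigma>0(1)])
      (use I(2) \<sigma>0(2) in simp_all)
  moreover have "D\<nu> p v \<bullet> ?c2 0 = - m * (cross3 (Df p v) (?c2 0) \<bullet> \<nu> p)"
    using cross_triple[of "\<nu> p" "Df p v" "?c2 0"] by (simp add: m)
  moreover have "\<alpha> * norm (Df p v) ^ 3 = cross3 (Df p v) (?c2 0) \<bullet> \<nu> p"
    using Df_eq_0_iff[OF assms(1)] assms(2) c(4,5)[OF I(2)] \<sigma>0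
    by (simp add: \<alpha> plane_curvature_def del: One_nat_def)
  ultimately show ?thesis
    by (simp add: mult.assoc)
qed

text \<open>II vanishes identically along the curve, so its derivative at 0 does too, which relates
  \<open>third_order\<close> to the acceleration. The absolute values appear because the curvature
  of a space curve carries no sign.\<close>

lemma asymptotic_curve_third_order:
  assumes "p \<in> U" "v \<noteq> 0"
    and m: "D\<nu> p v = - m *\<^sub>R cross3 (\<nu> p) (Df p v)"
    and "asymptotic_curve U f \<nu> p v I \<tau>"
  shows "2 * \<bar>m\<bar> * space_curvature (f \<circ> \<tau>) 0 * norm (Df p v) ^ 3 = \<bar>third_order p v\<bar>"
    and "space_curvature (f \<circ> \<tau>) 0 > 0 \<Longrightarrow> space_torsion (f \<circ> \<tau>) 0 = m"
proof -
  have I: "open I" "0 \<in> I" "smooth_on I \<tau>" "\<tau> ` I \<subseteq> U" and \<tau>0: "\<tau> 0 = p"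
    using assms(4) unfolding asymptotic_curve_def regular_curve_on_def by blast+
  obtain r where r: "r > 0" "curve_deriv 1 \<tau> 0 = r *\<^sub>R v"
    using assms(4) unfolding asymptotic_curve_def by blast
  let ?V = "Df p v"
  let ?c2 = "\<lambda>t. D2f (\<tau> t) (curve_deriv 1 \<tau> t) (curve_deriv 1 \<tau> t) + Df (\<tau> t) (curve_deriv 2 \<tau> t)"
  let ?c3 = "curve_deriv 3 (f \<circ> \<tau>) 0"
  define k where "k = cross3 ?V (?c2 0) \<bullet> \<nu> p"
  note c = composite_curve[OF I]
  note d\<tau> = curve_deriv_has_vector_derivative[OF I(3,1)]
  have II0: "II (\<tau> t) (curve_deriv 1 \<tau> t) (curve_deriv 1 \<tau> t) = 0" if "t \<in> I" for t
    using assms(4) that unfolding asymptotic_curve_def asymptotic_direction_def by blast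
  note third = third_derivative_normal_part[OF I(1,2,4) d\<tau>(1) d\<tau>(2)[OF I(2)] refl c(3) \<tau>0 r(2)]
  have "((\<lambda>t. II (\<tau> t) (curve_deriv 1 \<tau> t) (curve_deriv 1 \<tau> t)) has_vector_derivative 0) (at 0)"
    by (rule has_vector_derivative_transform_within_open[OF has_vector_derivative_const I(1,2)])
      (simp only: II0)
  from vector_derivative_unique_at[OF this third(1)]
  have "r ^ 3 * third_order p v = 2 * r * (D\<nu> p v \<bullet> ?c2 0)"
    by simp
  moreover have shape: "D\<nu> p v \<bullet> ?c2 0 = - m * k"
    using cross_triple[of "\<nu> p" ?V "?c2 0"] by (simp add: m k_def)
  ultimately have D: "r ^ 3 * third_order p v = - 2 * r * m * k"
    by simp
  \<comment> \<open>The term \<open>- 2 * r * m * k\<close> from \<open>D\<close> and the term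
    \<open>3 * r * m * k\<close> from the shape operator add up to this.\<close>
  have c3: "?c3 \<bullet> \<nu> p = r * m * k"
    using third(2) D shape by simp
  \<comment> \<open>The normal component of the acceleration is II of the velocity, hence zero.
    Velocity and acceleration are both tangent, and \<nu> plays the role of the binormal up to
    sign.\<close>
  have "\<nu> p \<bullet> ?c2 0 = 0"
    using II0[OF I(2)] normal_Df[OF assms(1)] \<tau>0
    by (simp add: second_fundamental_form_def inner_add_right inner_commute)
  then have "cross3 ?V (?c2 0) = k *\<^sub>R \<nu> p"
    unfolding k_def using cross_parallel_normal normal_unit[OF assms(1)] normal_Df[OF assms(1)] by blast
  then have cross: "cross3 (curve_deriv 1 (f \<circ> \<tau>) 0) (curve_deriv 2 (f \<circ> \<tau>) 0) = (r * k) *\<^sub>R \<nu> p"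
    using c(4,5)[OF I(2)] linear_scale[OF linear_Df[OF assms(1)]] r(2) \<tau>0
    by (simp add: cross_mult_left del: One_nat_def)
  have norm\<nu>: "norm (\<nu> p) = 1"
    using normal_unit[OF assms(1)] by (simp add: norm_eq_1)
  have V: "norm ?V > 0"
    using Df_eq_0_iff[OF assms(1)] assms(2) by simp
  have c1: "norm (curve_deriv 1 (f \<circ> \<tau>) 0) = r * norm ?V"
    using c(4)[OF I(2)] linear_scale[OF linear_Df[OF assms(1)]] r \<tau>0 by (simp del: One_nat_def)
  have curv: "space_curvature (f \<circ> \<tau>) 0 = (r * \<bar>k\<bar>) / (r * norm ?V) ^ 3"
    unfolding space_curvature_def cross c1 using r(1) norm\<nu> by (simp add: abs_mult)
  have "r ^ 3 * \<bar>third_order p v\<bar> = 2 * r * \<bar>m\<bar> * \<bar>k\<bar>"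
    using arg_cong[OF D, of abs] r(1) by (simp add: abs_mult)
  then show "2 * \<bar>m\<bar> * space_curvature (f \<circ> \<tau>) 0 * norm ?V ^ 3 = \<bar>third_order p v\<bar>"
    unfolding curv using r(1) V by (simp add: field_simps)
  show "space_torsion (f \<circ> \<tau>) 0 = m" if "space_curvature (f \<circ> \<tau>) 0 > 0"
  proof -
    have "k \<noteq> 0"
      using that curv by auto
    moreover have "\<nu> p \<bullet> ?c3 = r * m * k"
      using c3 by (simp only: inner_commute)
    ultimately show ?thesis
      unfolding space_torsion_def cross using r(1) norm\<nu> by (simp add: power2_eq_square field_simps)
  qed
qed

text \<open>In the normal plane the acceleration is orthogonal to \<open>D\<nu> p v\<close>, so the
  third derivative has normal component l^3 times \<open>third_order p v\<close>. The plane
  curvature vanishes at 0, and its derivative there sees only this component.\<close>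

lemma vertical_torsion_third_order:
  assumes "p \<in> U" "v \<noteq> 0"
    and m: "D\<nu> p v = - m *\<^sub>R cross3 (\<nu> p) (Df p v)"
    and "has_vertical_torsion U f \<nu> p v \<rho>"
  shows "\<bar>\<rho>\<bar> * norm (Df p v) ^ 3 = \<bar>third_order p v\<bar>"
proof -
  let ?V = "Df p v"
  let ?n = "cross3 (\<nu> p) ?V"
  obtain I c W where I: "open I" "0 \<in> I" "smooth_on I c" "\<And>t. t \<in> I \<Longrightarrow> curve_deriv 1 c t \<noteq> 0"
    and c0: "c 0 = f p" and sect: "c ` I = f ` U \<inter> normal_plane f \<nu> p v \<inter> W"
    and \<rho>: "\<rho> = deriv (plane_curvature (sgn ?n) c) 0 / norm (curve_deriv 1 c 0)"
    using assms(4) unfolding has_vertical_torsion_def regular_curve_on_def by blast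
  let ?c1 = "curve_deriv 1 c" and ?c2 = "curve_deriv 2 c" and ?c3 = "curve_deriv 3 c 0"
  note dc = curve_deriv_has_vector_derivative[OF I(3,1)]
  obtain \<gamma> \<gamma>1 \<gamma>2 where \<gamma>U: "\<gamma> ` I \<subseteq> U" and f\<gamma>: "\<And>t. t \<in> I \<Longrightarrow> f (\<gamma> t) = c t"
    and \<gamma>: "\<And>t. t \<in> I \<Longrightarrow> (\<gamma> has_vector_derivative \<gamma>1 t) (at t)"
      "\<And>t. t \<in> I \<Longrightarrow> (\<gamma>1 has_vector_derivative \<gamma>2 t) (at t)"
    using lift_curve[OF I(1) _ dc(1,2)] sect by blast
  have \<gamma>0: "\<gamma> 0 = p"
    using inj_on_surface f\<gamma>[OF I(2)] c0 \<gamma>U I(2) assms(1) by (auto simp: inj_on_def)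
  have c1: "?c1 t = Df (\<gamma> t) (\<gamma>1 t)" if "t \<in> I" for t
  proof -
    have "\<gamma> t \<in> U"
      using \<gamma>U that by blast
    from has_vector_derivative_transform_within_open[OF curve_on_surface(1)[OF this \<gamma>(1)[OF that] \<gamma>(1)[OF that]] I(1) that f\<gamma>]
    show ?thesis
      using vector_derivative_unique_at dc(1)[OF that] by blast
  qed
  have c2: "?c2 t = D2f (\<gamma> t) (\<gamma>1 t) (\<gamma>1 t) + Df (\<gamma> t) (\<gamma>2 t)" if "t \<in> I" for t
  proof -
    have "\<gamma> t \<in> U"
      using \<gamma>U that by blast
    from has_vector_derivative_transform_within_open[OF curve_on_surface(3)[OF this \<gamma>(1,2)[OF that]] I(1) that c1[symmetric]]
    show ?thesis
      using vector_derivative_unique_at dc(2)[OF that] by blast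
  qed
  have unit: "\<nu> p \<bullet> \<nu> p = 1"
    by (rule normal_unit[OF assms(1)])
  have \<nu>V: "\<nu> p \<bullet> ?V = 0"
    by (rule normal_Df[OF assms(1)])
  have V: "norm ?V > 0"
    using Df_eq_0_iff[OF assms(1)] assms(2) by simp
  have plane0: "c t \<bullet> ?n = f p \<bullet> ?n" if t: "t \<in> I" for t
  proof -
    have "c t \<in> normal_plane f \<nu> p v"
      using sect t by blast
    then obtain x where x: "x \<in> span {\<nu> p, ?V}" "c t = f p + x"
      by (auto simp: normal_plane_def)
    have "orthogonal ?n x"
      by (rule orthogonal_to_span[OF x(1)]) (auto simp: orthogonal_def dot_cross_self)
    then show ?thesis
      by (simp add: x(2) inner_add_left orthogonal_def inner_commute)
  qed
  have plane1: "?c1 t \<bullet> ?n = 0" if "t \<in> I" for t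
    using inner_const_derivative_zero[OF I(1) that plane0 dc(1)[OF that]] .
  have plane2: "?c2 t \<bullet> ?n = 0" if "t \<in> I" for t
    using inner_const_derivative_zero[OF I(1) that plane1 dc(2)[OF that]] .
  have \<nu>c1: "\<nu> p \<bullet> ?c1 0 = 0"
    using c1[OF I(2)] \<gamma>0 normal_Df[OF assms(1)] by simp
  \<comment> \<open>The velocity lies in the normal plane and is tangent to the surface, hence is a
    multiple of \<open>?V\<close>. The factor may be negative, since the section comes without a
    prescribed direction.\<close>
  obtain l where l: "?c1 0 = l *\<^sub>R ?V"
  proof -
    have "cross3 ?V (?c1 0) \<bullet> \<nu> p = ?c1 0 \<bullet> ?n"
      using cross_triple[of "\<nu> p" ?V "?c1 0"] by (simp add: inner_commute)
    then have "cross3 ?V (?c1 0) = 0"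
      using cross_parallel_normal[OF unit \<nu>V \<nu>c1] plane1[OF I(2)] by simp
    then show thesis
      using parallel_of_cross_zero[of ?V "?c1 0"] V that by auto
  qed
  have l0: "l \<noteq> 0"
    using I(4)[OF I(2)] l by auto
  have "Df p (\<gamma>1 0) = Df p (l *\<^sub>R v)"
    using c1[OF I(2)] \<gamma>0 l linear_scale[OF linear_Df[OF assms(1)]] by simp
  then have \<gamma>10: "\<gamma>1 0 = l *\<^sub>R v"
    using inj_Df[OF assms(1)] by (simp add: inj_eq)
  have shape: "D\<nu> p v \<bullet> ?c2 0 = 0"
    using plane2[OF I(2)] by (simp add: m inner_commute)
  have c3: "?c3 \<bullet> \<nu> p = l ^ 3 * third_order p v"
    using third_derivative_normal_part(2)[OF I(1,2) \<gamma>U \<gamma>(1) \<gamma>(2)[OF I(2)] c2 dc(3)[OF I(2)] \<gamma>0 \<gamma>10] shape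
    by simp
  \<comment> \<open>With this the acceleration is tangent, so its cross product with the velocity is
    parallel to \<open>\<nu> p\<close> and has no component along \<open>?n\<close>: the section has
    an inflection point.\<close>
  have "II p v v = 0"
    using II_eq_shape[OF assms(1), of v v] by (simp add: m dot_cross_self)
  then have "\<nu> p \<bullet> ?c2 0 = 0"
    using c2[OF I(2)] \<gamma>0 \<gamma>10 normal_Df[OF assms(1)]
      linear_scale[OF linear_D2f(1)[OF assms(1)]] linear_scale[OF linear_D2f(2)[OF assms(1)]]
    by (simp add: second_fundamental_form_def inner_add_right inner_commute)
  then have par: "cross3 (?c1 0) (?c2 0) = (cross3 (?c1 0) (?c2 0) \<bullet> \<nu> p) *\<^sub>R \<nu> p"
    by (rule cross_parallel_normal[OF unit \<nu>c1])
  have "\<nu> p \<bullet> sgn ?n = 0"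
    by (simp add: sgn_div_norm dot_cross_self)
  then have num0: "cross3 (?c1 0) (?c2 0) \<bullet> sgn ?n = 0"
    by (subst par) simp
  have "((\<lambda>t. cross3 (?c1 t) (?c2 t) \<bullet> sgn ?n) has_vector_derivative
      (cross3 (?c1 0) ?c3 + cross3 (?c2 0) (?c2 0)) \<bullet> sgn ?n) (at 0)"
    using bounded_linear.has_vector_derivative[OF bounded_linear_inner_left
        has_vector_derivative_cross3[OF dc(2)[OF I(2)] dc(3)[OF I(2)]]] .
  then have num: "((\<lambda>t. cross3 (?c1 t) (?c2 t) \<bullet> sgn ?n) has_real_derivative
      cross3 (?c1 0) ?c3 \<bullet> sgn ?n) (at 0)"
    by (simp add: has_real_derivative_iff_has_vector_derivative)
  have c1d: "?c1 differentiable at 0"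
    using dc(2)[OF I(2)] differentiableI_vector by blast
  have "(norm \<circ> ?c1) differentiable at 0"
    by (intro differentiable_chain_at c1d differentiable_norm_at I(4)[OF I(2)])
  then have "(\<lambda>t. norm (?c1 t) ^ 3) differentiable at 0"
    by (intro differentiable_power) (simp add: o_def)
  \<comment> \<open>Only the existence of \<open>d\<close> matters: in the quotient rule it is
    multiplied by the numerator, which vanishes at 0.\<close>
  then obtain d where den: "((\<lambda>t. norm (?c1 t) ^ 3) has_real_derivative d) (at 0)"
    using real_differentiable_def by blast
  have q: "norm (?c1 0) ^ 3 \<noteq> 0"
    using I(4)[OF I(2)] by simp
  have "(plane_curvature (sgn ?n) c has_real_derivative
      ((cross3 (?c1 0) ?c3 \<bullet> sgn ?n) * norm (?c1 0) ^ 3 - 0 * d) / (norm (?c1 0) ^ 3 * norm (?c1 0) ^ 3)) (at 0)"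
    using DERIV_divide[OF num den q] unfolding plane_curvature_def num0 .
  then have "(plane_curvature (sgn ?n) c has_real_derivative (cross3 (?c1 0) ?c3 \<bullet> sgn ?n) / norm (?c1 0) ^ 3) (at 0)"
    by (simp only: mult_zero_left diff_0_right nonzero_mult_divide_mult_cancel_right[OF q])
  then have \<rho>': "\<rho> = (cross3 (?c1 0) ?c3 \<bullet> sgn ?n) / norm (?c1 0) ^ 3 / norm (?c1 0)"
    using \<rho> DERIV_imp_deriv by metis
  \<comment> \<open>Cyclic symmetry moves \<open>?c3\<close> out of the cross product, and
    \<open>cross3 ?n ?V\<close> is a multiple of \<open>\<nu> p\<close>, so only the known normal
    component of \<open>?c3\<close> enters.\<close>
  have "cross3 ?V ?c3 \<bullet> ?n = cross3 ?n ?V \<bullet> ?c3"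
    using cross_triple[of ?n ?V ?c3] by simp
  also have "cross3 ?n ?V = - (?V \<bullet> ?V) *\<^sub>R \<nu> p"
    using Lagrange[of ?V "\<nu> p" ?V] cross_skew[of ?n ?V] \<nu>V by (simp add: inner_commute)
  finally have "cross3 ?V ?c3 \<bullet> ?n = - (norm ?V)\<^sup>2 * (l ^ 3 * third_order p v)"
    using c3 by (simp add: power2_norm_eq_inner inner_commute)
  then have "cross3 (?c1 0) ?c3 \<bullet> sgn ?n = - (norm ?V * l ^ 4 * third_order p v)"
    using V norm_cross_unit_orthogonal(2)[OF unit \<nu>V]
    by (simp add: l cross_mult_left sgn_div_norm field_simps power2_eq_square power3_eq_cube power4_eq_xxxx
        del: One_nat_def)
  then have "\<bar>\<rho>\<bar> = norm ?V * l ^ 4 * \<bar>third_order p v\<bar> / (\<bar>l\<bar> ^ 4 * norm ?V ^ 4)"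
    unfolding \<rho>' l by (simp add: abs_mult power_mult_distrib power3_eq_cube power4_eq_xxxx mult_ac)
  then show ?thesis
    using V l0 by (simp add: field_simps power3_eq_cube power4_eq_xxxx)
qed

end

text \<open>The asymptotic torsion is a relation, so the existence of a value stands beside the
  formula for all values and keeps the latter from being vacuous.\<close>

theorem proposition1p6:
  fixes U :: "(real^2) set" and f \<nu> :: "real^2 \<Rightarrow> real^3"
    and p v :: "real^2" and \<alpha> \<rho> \<beta> :: real
  assumes "open U" and "connected U"
    and "smooth_embedding_on U f"
    and "unit_normal_field U f \<nu>"
    and "p \<in> U"
    and "gaussian_curvature f \<nu> p < 0"
    and "asymptotic_direction f \<nu> p v"
    and "has_horizontal_curvature U f \<nu> p v \<alpha>"
    and "has_vertical_torsion U f \<nu> p v \<rho>"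
    and "has_asymptotic_curvature U f \<nu> p v \<beta>"
  shows "\<bar>\<alpha>\<bar> = 2 / 3 * \<beta> \<and>
    (\<beta> > 0 \<longrightarrow>
       (\<exists>\<delta>. has_asymptotic_torsion U f \<nu> p v \<delta>) \<and>
       (\<forall>\<delta>. has_asymptotic_torsion U f \<nu> p v \<delta> \<longrightarrow> \<bar>\<delta>\<bar> * \<beta> = \<bar>\<rho>\<bar> / 2) \<and>
       gaussian_curvature f \<nu> p = - \<rho>\<^sup>2 / (9 * \<alpha>\<^sup>2))"
proof -
  interpret surface_patch U f \<nu>
    using assms by unfold_locales
  have v: "v \<noteq> 0"
    using assms(7) by (simp add: asymptotic_direction_def)
  obtain m where m: "D\<nu> p v = - m *\<^sub>R cross3 (\<nu> p) (Df p v)" and K: "gaussian_curvature f \<nu> p = - m\<^sup>2"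
    using asymptotic_direction_shape[OF assms(5,7)] by blast
  \<comment> \<open>Negative curvature enters here: it allows \<open>m\<close> to be cancelled when
    \<alpha> and \<beta> are compared.\<close>
  have m0: "\<bar>m\<bar> > 0"
    using K assms(6) by auto
  define T where "T = third_order p v"
  define N where "N = norm (Df p v) ^ 3"
  have N: "N > 0"
    using Df_eq_0_iff[OF assms(5)] v by (simp add: N_def)
  have \<alpha>: "3 * m * \<alpha> * N = - T"
    unfolding N_def T_def by (rule horizontal_curvature_third_order[OF assms(5) v m assms(8)])
  have \<rho>: "\<bar>\<rho>\<bar> * N = \<bar>T\<bar>"
    unfolding N_def T_def by (rule vertical_torsion_third_order[OF assms(5) v m assms(9)])
  note asym = asymptotic_curve_third_order[OF assms(5) v m, folded N_def T_def]
  obtain I \<tau> where \<tau>: "asymptotic_curve U f \<nu> p v I \<tau>" "\<beta> = space_curvature (f \<circ> \<tau>) 0"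
    using assms(10) unfolding has_asymptotic_curvature_def by blast
  have \<beta>: "2 * \<bar>m\<bar> * \<beta> * N = \<bar>T\<bar>"
    using asym(1)[OF \<tau>(1)] \<tau>(2) by simp
  have \<alpha>': "3 * \<bar>m\<bar> * \<bar>\<alpha>\<bar> * N = \<bar>T\<bar>"
    using arg_cong[OF \<alpha>, of abs] N by (simp add: abs_mult)
  have "\<bar>m\<bar> * N * (3 * \<bar>\<alpha>\<bar>) = \<bar>m\<bar> * N * (2 * \<beta>)"
    using \<alpha>' \<beta> by (simp add: mult_ac)
  then have \<alpha>\<beta>: "\<bar>\<alpha>\<bar> = 2 / 3 * \<beta>"
    using m0 N by simp
  have \<rho>m: "\<bar>\<rho>\<bar> = 2 * \<bar>m\<bar> * \<beta>"
    using \<beta> \<rho> N by (metis less_irrefl mult_right_cancel)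
  have "(\<exists>\<delta>. has_asymptotic_torsion U f \<nu> p v \<delta>) \<and>
       (\<forall>\<delta>. has_asymptotic_torsion U f \<nu> p v \<delta> \<longrightarrow> \<bar>\<delta>\<bar> * \<beta> = \<bar>\<rho>\<bar> / 2) \<and>
       gaussian_curvature f \<nu> p = - \<rho>\<^sup>2 / (9 * \<alpha>\<^sup>2)" if "\<beta> > 0"
  proof (intro conjI allI impI)
    show "\<exists>\<delta>. has_asymptotic_torsion U f \<nu> p v \<delta>"
      using \<tau> that unfolding has_asymptotic_torsion_def by blast
  next
    fix \<delta>
    assume "has_asymptotic_torsion U f \<nu> p v \<delta>"
    \<comment> \<open>The curve witnessing \<delta> may differ from the one witnessing \<beta>, but
      every asymptotic curve for \<open>v\<close> with positive curvature at 0 has torsion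
      \<open>m\<close> there.\<close>
    then have "\<delta> = m"
      using asym(2) unfolding has_asymptotic_torsion_def by blast
    then show "\<bar>\<delta>\<bar> * \<beta> = \<bar>\<rho>\<bar> / 2"
      using \<rho>m by simp
  next
    \<comment> \<open>Squaring removes the absolute values, and eliminating \<beta> leaves \<rho>
      and \<alpha> related through the square of \<open>m\<close>, which is minus the Gaussian
      curvature.\<close>
    have "\<bar>\<rho>\<bar>\<^sup>2 = (2 * \<bar>m\<bar> * \<beta>)\<^sup>2" "\<bar>\<alpha>\<bar>\<^sup>2 = (2 / 3 * \<beta>)\<^sup>2"
      by (simp_all only: \<rho>m \<alpha>\<beta>)
    then have "\<rho>\<^sup>2 = m\<^sup>2 * (9 * \<alpha>\<^sup>2)" "\<alpha>\<^sup>2 \<noteq> 0"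
      using that by (auto simp: power_mult_distrib power_divide)
    then show "gaussian_curvature f \<nu> p = - \<rho>\<^sup>2 / (9 * \<alpha>\<^sup>2)"
      using K by simp
  qed
  with \<alpha>\<beta> show ?thesis
    by blast
qed

end
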